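(* For every $\epsilon>0$ there exists $n_0>0$ such that $$\frac{|\mathbb P_x(\tau_n<\tau_0)-\mathbb P_{T_n(x)}(\tau<\infty)|}{\mathbb P_x(\tau_n<\tau_0)}\le \rho^{\,n(1-g(x/n)-\epsilon)}$$ for all integers $n>n_0$ and all $x\in\bar R_{\rho,n}$. In particular, if $x_n\in\mathbb Z_+^d$ is a sequence with $x_n/n\to x\in A\setminus R_\rho$, then the relative error decays exponentially with rate $-\log(\rho)(1-g(x))>0$, i.e. $$\liminf_{n\to\infty}-\frac1n\log\left(\frac{|\mathbb P_{x_n}(\tau_n<\tau_0)-\mathbb P_{T_n(x_n)}(\tau<\infty)|}{\mathbb P_{x_n}(\tau_n<\tau_0)}\right)\ge-\log(\rho)(1-g(x)).$$
   Context: Let $d\ge 3$ be an integer, $\lambda,\mu_1,\dots,\mu_d>0$ with $\lambda+\sum_i\mu_i=1$, and $e_1,\dots,e_d$ the standard basis of $\mathbb Z^d$. Let $I_1,I_2,\dots$ be i.i.d. with $\mathbb P(I_k=e_1)=\lambda$, $\mathbb P(I_k=-e_i+e_{i+1})=\mu_i$ for $1\le i\le d-1$, and $\mathbb P(I_k=-e_d)=\mu_d$. The constrained walk $X$ on $\mathbb Z_+^d$ is $X_{k+1}=X_k+\pi(X_k,I_{k+1})$ with $\pi(x,v)=v$ if $x+v\in\mathbb Z_+^d$ and $\pi(x,v)=0$ otherwise. $\mathbb P_x$ is the law with $X_0=x$. Stability is assumed: $\lambda<\mu_i$ for all $i$. Put $\rho_i=\lambda/\mu_i$ and $\rho=\max_i\rho_i<1$.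 For an integer $n\ge 0$, $\tau_n=\inf\{k\ge0:\sum_{i=1}^dX_k(i)=n\}$ (so $\tau_0$ is the hitting time of $0$). Let $\mathcal I_1$ be the $d\times d$ diagonal matrix with $\mathcal I_1(1,1)=-1$ and $\mathcal I_1(j,j)=1$ for $j>1$; $T_n(x)=ne_1+\mathcal I_1x=(n-x(1),x(2),\dots,x(d))$. Let $\Omega_Y=\mathbb Z\times\mathbb Z_+^{d-1}$. The process $Y$ on $\Omega_Y$ is $Y_{k+1}=Y_k+\pi_1(Y_k,\mathcal I_1I_{k+1})$, with $\pi_1(y,v)=v$ if $y+v\in\Omega_Y$ and $0$ otherwise. $\mathbb P_y(\tau<\infty)$ is the probability, with $Y_0=y$, that $\tau=\inf\{k\ge0:Y_k\in\partial B\}$ is finite, where $\partial B=\{y\in\Omega_Y:y(1)=\sum_{j=2}^dy(j)\}$. Define $R_\rho=\bigcap_{i=1}^d\{x\in\mathbb R_+^d:\sum_{j=1}^ix(j)\le1-\frac{\log\rho}{\log\rho_i}\}$, $\bar R_{\rho,n}=\bigcup_{i=1}^d\{x\in\mathbb Z_+^d:\sum_{j=1}^ix(j)\ge1+n(1-\frac{\log\rho}{\log\rho_i})\}$, $A=\{x\in\mathbb R_+^d:\sum_{i=1}^dx(i)\le1\}$, and $g:\mathbb R_+^d\to\mathbb R$, $g(x)=\min_{i\in\{1,\dots,d\}}\left(1-\sum_{j=1}^ix(j)\right)\log_\rho\rho_i$, where $\log_\rho\rho_i=\log\rho_i/\log\rho$. By convention $-\log 0=+\infty$. *)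

theory Defs
  imports "HOL-Probability.Probability" "HOL-Library.Function_Algebras"
begin

text \<open>
  Vectors with \<open>d\<close> coordinates over a ring are functions \<open>x :: nat \<Rightarrow> 'a\<close> that vanish outside the
  index range \<open>{1..d}\<close>. Sums, differences and the zero vector are the pointwise ones of
  \<open>Function_Algebras\<close>.
\<close>

definition vectors :: "nat \<Rightarrow> (nat \<Rightarrow> 'a::zero) set" where
  "vectors d = {x. \<forall>j. j \<notin> {1..d} \<longrightarrow> x j = 0}"

definition orthant :: "nat \<Rightarrow> (nat \<Rightarrow> 'a::{zero,ord}) set" where
  "orthant d = {x \<in> vectors d. \<forall>j\<in>{1..d}. 0 \<le> x j}"

definition unit_vec :: "nat \<Rightarrow> nat \<Rightarrow> int" where
  "unit_vec i = (\<lambda>j. of_bool (j = i))"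

definition scaled :: "nat \<Rightarrow> (nat \<Rightarrow> int) \<Rightarrow> nat \<Rightarrow> real" where
  "scaled n x = (\<lambda>j. real_of_int (x j) / real n)"


text \<open>
  \<open>I k\<close> for \<open>k \<ge> 1\<close> are i.i.d. random elements of the countable discrete space of integer vectors.
  Measurability refers to that space, not to the uncountable type \<open>nat \<Rightarrow> int\<close>. The listed
  probabilities sum to 1 in the intended use, so they determine the law.
\<close>

definition iid_increments ::
  "nat \<Rightarrow> real \<Rightarrow> (nat \<Rightarrow> real) \<Rightarrow> 'w measure \<Rightarrow> (nat \<Rightarrow> 'w \<Rightarrow> nat \<Rightarrow> int) \<Rightarrow> bool" where
  "iid_increments d lam mu M I \<longleftrightarrow>
     prob_space.indep_vars M (\<lambda>_. count_space (vectors d)) I {1..} \<and>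
     (\<forall>k\<ge>1.
        measure M {\<omega> \<in> space M. I k \<omega> = unit_vec 1} = lam \<and>
        (\<forall>i\<in>{1..<d}. measure M {\<omega> \<in> space M. I k \<omega> = - unit_vec i + unit_vec (i + 1)} = mu i) \<and>
        measure M {\<omega> \<in> space M. I k \<omega> = - unit_vec d} = mu d)"

definition constrain :: "(nat \<Rightarrow> int) set \<Rightarrow> (nat \<Rightarrow> int) \<Rightarrow> (nat \<Rightarrow> int) \<Rightarrow> (nat \<Rightarrow> int)" where
  "constrain S x v = (if x + v \<in> S then v else 0)"

primrec constrained_walk ::
  "(nat \<Rightarrow> int) set \<Rightarrow> (nat \<Rightarrow> int) \<Rightarrow> (nat \<Rightarrow> nat \<Rightarrow> int) \<Rightarrow> nat \<Rightarrow> (nat \<Rightarrow> int)" where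
  "constrained_walk S x v 0 = x"
| "constrained_walk S x v (Suc k) =
     constrained_walk S x v k + constrain S (constrained_walk S x v k) (v (Suc k))"

definition hitting_time :: "(nat \<Rightarrow> int) set \<Rightarrow> (nat \<Rightarrow> nat \<Rightarrow> int) \<Rightarrow> enat" where
  "hitting_time S Z = Inf {enat k |k. Z k \<in> S}"

definition diag_I1 :: "nat \<Rightarrow> int" where
  "diag_I1 j = (if j = 1 then -1 else 1)"

definition reflect :: "(nat \<Rightarrow> int) \<Rightarrow> (nat \<Rightarrow> int)" where
  "reflect x = (\<lambda>j. diag_I1 j * x j)"

definition T_map :: "nat \<Rightarrow> (nat \<Rightarrow> int) \<Rightarrow> (nat \<Rightarrow> int)" where
  "T_map n x = (\<lambda>j. int n * unit_vec 1 j) + reflect x"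

definition walk_X ::
  "nat \<Rightarrow> (nat \<Rightarrow> 'w \<Rightarrow> nat \<Rightarrow> int) \<Rightarrow> (nat \<Rightarrow> int) \<Rightarrow> 'w \<Rightarrow> nat \<Rightarrow> (nat \<Rightarrow> int)" where
  "walk_X d I x \<omega> = constrained_walk (orthant d) x (\<lambda>k. I k \<omega>)"

definition Omega_Y :: "nat \<Rightarrow> (nat \<Rightarrow> int) set" where
  "Omega_Y d = {y \<in> vectors d. \<forall>j\<in>{2..d}. 0 \<le> y j}"

definition walk_Y ::
  "nat \<Rightarrow> (nat \<Rightarrow> 'w \<Rightarrow> nat \<Rightarrow> int) \<Rightarrow> (nat \<Rightarrow> int) \<Rightarrow> 'w \<Rightarrow> nat \<Rightarrow> (nat \<Rightarrow> int)" where
  "walk_Y d I y \<omega> = constrained_walk (Omega_Y d) y (\<lambda>k. reflect (I k \<omega>))"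

definition tau_X ::
  "nat \<Rightarrow> (nat \<Rightarrow> 'w \<Rightarrow> nat \<Rightarrow> int) \<Rightarrow> nat \<Rightarrow> (nat \<Rightarrow> int) \<Rightarrow> 'w \<Rightarrow> enat" where
  "tau_X d I n x \<omega> = hitting_time {z. (\<Sum>j=1..d. z j) = int n} (walk_X d I x \<omega>)"

definition boundary_B :: "nat \<Rightarrow> (nat \<Rightarrow> int) set" where
  "boundary_B d = {y \<in> Omega_Y d. y 1 = (\<Sum>j=2..d. y j)}"

definition tau_Y ::
  "nat \<Rightarrow> (nat \<Rightarrow> 'w \<Rightarrow> nat \<Rightarrow> int) \<Rightarrow> (nat \<Rightarrow> int) \<Rightarrow> 'w \<Rightarrow> enat" where
  "tau_Y d I y \<omega> = hitting_time (boundary_B d) (walk_Y d I y \<omega>)"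

definition prob_X ::
  "nat \<Rightarrow> 'w measure \<Rightarrow> (nat \<Rightarrow> 'w \<Rightarrow> nat \<Rightarrow> int) \<Rightarrow> nat \<Rightarrow> (nat \<Rightarrow> int) \<Rightarrow> real" where
  "prob_X d M I n x = measure M {\<omega> \<in> space M. tau_X d I n x \<omega> < tau_X d I 0 x \<omega>}"

definition prob_Y ::
  "nat \<Rightarrow> 'w measure \<Rightarrow> (nat \<Rightarrow> 'w \<Rightarrow> nat \<Rightarrow> int) \<Rightarrow> (nat \<Rightarrow> int) \<Rightarrow> real" where
  "prob_Y d M I y = measure M {\<omega> \<in> space M. tau_Y d I y \<omega> < \<infinity>}"

definition rel_error ::
  "nat \<Rightarrow> 'w measure \<Rightarrow> (nat \<Rightarrow> 'w \<Rightarrow> nat \<Rightarrow> int) \<Rightarrow> nat \<Rightarrow> (nat \<Rightarrow> int) \<Rightarrow> real" where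
  "rel_error d M I n x = \<bar>prob_X d M I n x - prob_Y d M I (T_map n x)\<bar> / prob_X d M I n x"


definition rho_i :: "real \<Rightarrow> (nat \<Rightarrow> real) \<Rightarrow> nat \<Rightarrow> real" where
  "rho_i lam mu i = lam / mu i"

definition rho_max :: "nat \<Rightarrow> real \<Rightarrow> (nat \<Rightarrow> real) \<Rightarrow> real" where
  "rho_max d lam mu = Max (rho_i lam mu ` {1..d})"

definition R_rho :: "nat \<Rightarrow> real \<Rightarrow> (nat \<Rightarrow> real) \<Rightarrow> (nat \<Rightarrow> real) set" where
  "R_rho d lam mu =
     (\<Inter>i\<in>{1..d}. {x \<in> orthant d.
        (\<Sum>j=1..i. x j) \<le> 1 - ln (rho_max d lam mu) / ln (rho_i lam mu i)})"

definition R_bar :: "nat \<Rightarrow> real \<Rightarrow> (nat \<Rightarrow> real) \<Rightarrow> nat \<Rightarrow> (nat \<Rightarrow> int) set" where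
  "R_bar d lam mu n =
     (\<Union>i\<in>{1..d}. {x \<in> orthant d.
        real_of_int (\<Sum>j=1..i. x j)
          \<ge> 1 + real n * (1 - ln (rho_max d lam mu) / ln (rho_i lam mu i))})"

definition A_set :: "nat \<Rightarrow> (nat \<Rightarrow> real) set" where
  "A_set d = {x \<in> orthant d. (\<Sum>i=1..d. x i) \<le> 1}"

definition g_fun :: "nat \<Rightarrow> real \<Rightarrow> (nat \<Rightarrow> real) \<Rightarrow> (nat \<Rightarrow> real) \<Rightarrow> real" where
  "g_fun d lam mu x =
     Min ((\<lambda>i. (1 - (\<Sum>j=1..i. x j)) * log (rho_max d lam mu) (rho_i lam mu i)) ` {1..d})"

text \<open>Here \<open>- ln 0 = \<infinity>\<close>, unlike the library's real-valued \<open>ln\<close>, for which \<open>ln 0 = 0\<close>.\<close>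

definition neg_log :: "real \<Rightarrow> ereal" where
  "neg_log r = (if r = 0 then \<infinity> else ereal (- ln r))"

end

(*
In terms of the partial sums S_i = x(1) + ... + x(i), one step of X adds 1 to every S_i (an arrival)
or replaces S_v by max (S_v - 1) S_(v-1) (a service at node v, with S_0 = 0). Reflecting Y back by T_n
gives the same dynamics, except that node 1 has no floor. These maps are max-plus linear, so X is
pathwise the maximum of the free walk started at x and of free walks restarted at 0 at all later
times. Hence the events "X reaches n before 0" and "the free walk reaches n" can only differ if some
free walk, restarted at 0 while X has not yet emptied, reaches n. A supermartingale
sum_i c^i r^(S_i), r < 1/rho, bounds the probability for one restarted walk by a multiple of r^(-n),
and the same function with r close to 1 is a Lyapunov function bounding the expected number of
restart times by a multiple of r^n. So the absolute error is at most C rho^(n (1 - eps)).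

For the relative error, (mu_i / lambda)^(S_i) is a submartingale for X, which gives
P_x(tau_n < tau_0) >= (1 - rho) rho^(n g(x/n)) on the region where g(x/n) < 1. If sum x(i) >= n, both
probabilities are 1 by recurrence.
*)
theory Submission
  imports Defs
begin

section \<open>Words of steps and the dynamics of partial sums\<close>

text \<open>Letters turn every event of the first k steps into a finite sum over words of length k,
  so no filtration or optional stopping theorem occurs: each martingale argument is an induction on
  k with the starting state generalised. The price is a finite horizon. The bounds are therefore
  either uniform in k or carry the probability that X has not yet emptied as a remainder, and k
  tends to infinity only at the end. One value of r cannot serve both uses of the energy. Reaching n
  from 0 needs r close to 1/\<rho>, but for that r the energy of a state with total n is itself of
  order r^n and would cancel the gain. With r = \<rho>^(-(1 - \<epsilon>/2)) for one restarted walk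
  and r = \<rho>^(-\<epsilon>/2) for the number of restarts, the product is of order \<rho>^(n (1 -
  \<epsilon>)). This is uniform over all starts with total at most n; the start matters only for the
  lower bound on the denominator.\<close>

text \<open>Step 0 is an arrival (\<open>p 0\<close> is \<open>\<lambda>\<close>), step \<open>v \<ge> 1\<close> a service at node \<open>v\<close> (\<open>p v\<close> is \<open>\<mu>\<^sub>v\<close>).\<close>

locale tandem =
  fixes d :: nat and p :: "nat \<Rightarrow> real"
  assumes d_pos: "d \<ge> 1"
    and p_pos: "\<And>v. v \<le> d \<Longrightarrow> p v > 0"
    and p_sum: "(\<Sum>v\<le>d. p v) = 1"
    and stable: "\<And>v. v \<in> {1..d} \<Longrightarrow> p 0 < p v"
begin

text \<open>Expectation over k independent letters of law \<open>p\<close>. The first letter is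
  peeled off, as in the recursions of \<open>win\<close>, \<open>hit\<close>, \<open>exceed\<close>,
  \<open>nonzero\<close> and \<open>restart\<close>, so that first-step analysis amounts to
  unfolding.\<close>

primrec word_mean :: "nat \<Rightarrow> (nat list \<Rightarrow> real) \<Rightarrow> real" where
  "word_mean 0 f = f []"
| "word_mean (Suc k) f = (\<Sum>v\<le>d. p v * word_mean k (\<lambda>w. f (v # w)))"

lemma word_mean_cong:
  assumes "\<And>w. length w = k \<Longrightarrow> set w \<subseteq> {..d} \<Longrightarrow> f w = g w"
  shows "word_mean k f = word_mean k g"
  using assms
proof (induction k arbitrary: f g)
  case (Suc k)
  have "word_mean k (\<lambda>w. f (v # w)) = word_mean k (\<lambda>w. g (v # w))" if "v \<le> d" for v
    using that by (intro Suc.IH Suc.prems) auto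
  then show ?case by (auto intro!: sum.cong)
qed simp

lemma word_mean_mono:
  assumes "\<And>w. length w = k \<Longrightarrow> set w \<subseteq> {..d} \<Longrightarrow> f w \<le> g w"
  shows "word_mean k f \<le> word_mean k g"
  using assms
proof (induction k arbitrary: f g)
  case (Suc k)
  have "word_mean k (\<lambda>w. f (v # w)) \<le> word_mean k (\<lambda>w. g (v # w))" if "v \<le> d" for v
    using that by (intro Suc.IH Suc.prems) auto
  then show ?case
    by (auto intro!: sum_mono mult_left_mono simp: p_pos less_imp_le)
qed simp

lemma word_mean_const [simp]: "word_mean k (\<lambda>_. c) = c"
  by (induction k) (simp_all add: p_sum flip: sum_distrib_right)

lemma word_mean_cmult: "word_mean k (\<lambda>w. c * f w) = c * word_mean k f"
  by (induction k arbitrary: f) (simp_all add: sum_distrib_left mult.left_commute)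

lemma word_mean_add: "word_mean k (\<lambda>w. f w + g w) = word_mean k f + word_mean k g"
  by (induction k arbitrary: f g) (simp_all add: sum.distrib distrib_left)

lemma word_mean_diff: "word_mean k (\<lambda>w. f w - g w) = word_mean k f - word_mean k g"
  by (induction k arbitrary: f g) (simp_all add: sum_subtractf right_diff_distrib)

lemma word_mean_append:
  "word_mean (k + l) f = word_mean k (\<lambda>w. word_mean l (\<lambda>w'. f (w @ w')))"
  by (induction k arbitrary: f) simp_all

lemma word_mean_nonneg:
  assumes "\<And>w. 0 \<le> f w"
  shows "0 \<le> word_mean k f"
  using word_mean_mono[of k "\<lambda>_. 0" f] assms by simp

lemma word_mean_le_const:
  assumes "\<And>w. f w \<le> c"
  shows "word_mean k f \<le> c"
  using word_mean_mono[of k f "\<lambda>_. c"] assms by simp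

lemma word_mean_Suc_snoc:
  "word_mean (Suc k) f = word_mean k (\<lambda>w. \<Sum>v\<le>d. p v * f (w @ [v]))"
  using word_mean_append[of k 1 f] by simp

text \<open>The word on which f vanishes carries weight at least q^k, and f is at most 1 on all
  others. In the Foster argument below, the missing word is one that empties the queues.\<close>

lemma word_mean_missing_word:
  assumes le1: "\<And>w. f w \<le> 1"
    and "length w = k" "set w \<subseteq> {..d}" "f w = 0"
    and q: "0 \<le> q" "\<And>v. v \<le> d \<Longrightarrow> q \<le> p v"
  shows "word_mean k f \<le> 1 - q ^ k"
  using assms(1-4)
proof (induction k arbitrary: f w)
  case (Suc k)
  then obtain v w' where w: "w = v # w'" by (cases w) auto
  have v: "v \<le> d" using Suc.prems w by auto
  have "word_mean k (\<lambda>w. f (v # w)) \<le> 1 - q ^ k"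
    using Suc.prems w by (intro Suc.IH[of _ w']) auto
  then have "p v * word_mean k (\<lambda>w. f (v # w)) \<le> p v * (1 - q ^ k)"
    using p_pos[OF v] by (intro mult_left_mono) auto
  also have "\<dots> \<le> p v - q * q ^ k"
    using mult_right_mono[OF q(2)[OF v] zero_le_power[OF q(1), of k]] by (simp add: algebra_simps)
  finally have 1: "p v * word_mean k (\<lambda>w. f (v # w)) \<le> p v - q ^ Suc k" by simp
  have 2: "(\<Sum>u\<in>{..d}-{v}. p u * word_mean k (\<lambda>w. f (u # w))) \<le> (\<Sum>u\<in>{..d}-{v}. p u)"
  proof (rule sum_mono)
    fix u assume u: "u \<in> {..d} - {v}"
    then have "p u * word_mean k (\<lambda>w. f (u # w)) \<le> p u * 1"
      using p_pos[of u] Suc.prems(1) by (intro mult_left_mono word_mean_le_const) auto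
    then show "p u * word_mean k (\<lambda>w. f (u # w)) \<le> p u" by simp
  qed
  have "word_mean (Suc k) f = p v * word_mean k (\<lambda>w. f (v # w))
      + (\<Sum>u\<in>{..d}-{v}. p u * word_mean k (\<lambda>w. f (u # w)))"
    using v by (simp add: sum.remove[of "{..d}" v])
  also have "\<dots> \<le> p v - q ^ Suc k + (\<Sum>u\<in>{..d}-{v}. p u)" using 1 2 by simp
  also have "\<dots> = 1 - q ^ Suc k"
    using p_sum v by (simp add: sum.remove[of "{..d}" v])
  finally show ?case .
qed simp

text \<open>\<open>True\<close> is the walk X, whose node 1 has the floor \<open>S 0 = 0\<close>; \<open>False\<close> is the reflected
  walk Y, whose node 1 is unconstrained.\<close>

definition step :: "bool \<Rightarrow> (nat \<Rightarrow> int) \<Rightarrow> nat \<Rightarrow> (nat \<Rightarrow> int)" where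
  "step b S v = (\<lambda>i. if v = 0 then S i + of_bool (0 < i)
     else if i = v then (if v = 1 \<and> \<not> b then S v - 1 else max (S v - 1) (S (v - 1)))
     else S i)"

text \<open>The partial sums of a vector of the orthant: S i - S (i - 1) is the length of queue i,
  so S d = 0 says that all queues are empty.\<close>

definition queue_state :: "(nat \<Rightarrow> int) \<Rightarrow> bool" where
  "queue_state S \<longleftrightarrow> S 0 = 0 \<and> (\<forall>i\<in>{1..d}. S (i - 1) \<le> S i)"

lemma queue_state_mono:
  assumes "queue_state S" "i \<le> j" "j \<le> d"
  shows "S i \<le> S j"
  using assms(2,3)
proof (induction j)
  case (Suc j)
  show ?case
  proof (cases "i = Suc j")
    case False
    then have "S i \<le> S j" using Suc by auto
    also have "S j \<le> S (Suc j)" using assms(1) Suc.prems by (force simp: queue_state_def)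
    finally show ?thesis .
  qed simp
qed simp

lemma queue_state_nonneg: "queue_state S \<Longrightarrow> i \<le> d \<Longrightarrow> 0 \<le> S i"
  using queue_state_mono[of S 0 i] by (simp add: queue_state_def)

lemma queue_state_empty:
  assumes "queue_state S" "S d = 0" "i \<le> d"
  shows "S i = 0"
  using queue_state_mono[of S i d] queue_state_nonneg[of S i] assms by simp

lemma queue_state_step:
  assumes "queue_state S"
  shows "queue_state (step True S v)"
  unfolding queue_state_def
proof (intro conjI ballI)
  show "step True S v 0 = 0" using assms by (simp add: step_def queue_state_def)
next
  fix i assume i: "i \<in> {1..d}"
  then have le: "S (i - 1) \<le> S i" using assms by (auto simp: queue_state_def)
  consider "v = 0" | "v = i" "v > 0" | "v = i - 1" "v > 0" | "v \<noteq> i" "v \<noteq> i - 1" "v > 0" by linarith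
  then show "step True S v (i - 1) \<le> step True S v i"
  proof cases
    case 3
    then have "v \<in> {1..d}" using i by auto
    then have "S (v - 1) \<le> S v" using assms unfolding queue_state_def by blast
    moreover have "i \<noteq> i - 1" using i by auto
    ultimately show ?thesis using 3 le i by (simp add: step_def)
  qed (use i le in \<open>(cases "i = 1"; simp add: step_def)+\<close>)
qed

lemma step_total_le:
  assumes "queue_state S"
  shows "step b S v d \<le> S d + 1"
proof (cases "v = d \<and> v > 0")
  case True
  then have "S (v - 1) \<le> S v"
    using assms queue_state_mono[of S "v - 1" v] by simp
  then show ?thesis using True by (auto simp: step_def)
qed (auto simp: step_def)

lemma step_total_ge: "S d - 1 \<le> step b S v d"
  by (auto simp: step_def)

text \<open>Only an arrival or a service at node i can move S i; all other letters leave \<phi> (S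
  i) alone. Both the supermartingale and the submartingale estimates start from this.\<close>

lemma sum_step:
  fixes \<phi> :: "int \<Rightarrow> real"
  assumes "i \<in> {1..d}"
  shows "(\<Sum>v\<le>d. p v * \<phi> (step b S v i)) =
    p 0 * \<phi> (S i + 1) + p i * \<phi> (step b S i i) + (1 - p 0 - p i) * \<phi> (S i)"
proof -
  have i: "0 \<in> {..d}" "i \<in> {..d} - {0}" using assms by auto
  have split: "(\<Sum>v\<le>d. f v) = f 0 + (f i + (\<Sum>v\<in>{..d}-{0}-{i}. f v))" for f :: "nat \<Rightarrow> real"
    using i by (simp add: sum.remove[of "{..d}" 0] sum.remove[of "{..d} - {0}" i])
  have rest: "(\<Sum>v\<in>{..d}-{0}-{i}. p v * \<phi> (step b S v i)) = (\<Sum>v\<in>{..d}-{0}-{i}. p v) * \<phi> (S i)"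
    unfolding sum_distrib_right by (intro sum.cong) (auto simp: step_def)
  have 1: "(\<Sum>v\<in>{..d}-{0}-{i}. p v) = 1 - p 0 - p i"
    using p_sum split[of p] by simp
  show ?thesis
    unfolding split rest 1 using assms by (simp add: step_def)
qed

section \<open>An exponential Lyapunov function\<close>

definition energy :: "real \<Rightarrow> real \<Rightarrow> (nat \<Rightarrow> int) \<Rightarrow> real" where
  "energy r c S = (\<Sum>i=1..d. c ^ i * r powr S i)"

lemma energy_nonneg: "0 \<le> c \<Longrightarrow> 0 \<le> energy r c S"
  unfolding energy_def by (intro sum_nonneg) auto

lemma energy_ge_total: "0 \<le> c \<Longrightarrow> c ^ d * r powr S d \<le> energy r c S"
  unfolding energy_def using d_pos by (intro member_le_sum) auto

lemma energy_le:
  assumes "0 \<le> c" "c \<le> 1" "1 \<le> r" "\<And>i. i \<in> {1..d} \<Longrightarrow> S i \<le> N"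
  shows "energy r c S \<le> real d * r powr N"
proof -
  have "energy r c S \<le> (\<Sum>i=1..d. 1 * r powr N)"
    unfolding energy_def using assms
    by (intro sum_mono mult_mono) (auto intro!: power_le_one powr_mono)
  then show ?thesis by simp
qed

text \<open>Away from its floor, r^(S i) changes in mean by the factor 1 - (r - 1) * (p i / r - p
  0), which is below 1 exactly for 1 < r < p i / p 0. So \<delta> is a contraction rate common to
  all nodes, and c \<le> \<delta> / 2 keeps half of it after the coupling of neighbouring nodes is
  paid for.\<close>

definition admissible :: "real \<Rightarrow> real \<Rightarrow> real \<Rightarrow> bool" where
  "admissible r \<delta> c \<longleftrightarrow> 1 < r \<and> 0 < \<delta> \<and> 0 < c \<and> c \<le> \<delta> / 2 \<and> c \<le> 1 \<and>
     (\<forall>i\<in>{1..d}. \<delta> \<le> (r - 1) * (p i / r - p 0))"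

text \<open>Bounding the maximum in \<open>step\<close> by a sum, level i picks up at most r^(S (i -
  1)) from its floor. With the weight c^i this is c times the term already present at level i - 1,
  so the coupling costs at most c times the energy. The floor 0 of node 1 contributes a constant for
  X and nothing for the free walk, whose energy is thus a supermartingale.\<close>

lemma energy_step:
  assumes adm: "admissible r \<delta> c" and S0: "b \<Longrightarrow> S 0 = 0"
  shows "(\<Sum>v\<le>d. p v * energy r c (step b S v)) \<le> (1 - \<delta> / 2) * energy r c S + of_bool b"
proof -
  have r: "1 < r" and \<delta>: "0 < \<delta>" and c: "0 < c" "c \<le> \<delta> / 2" "c \<le> 1"
    and gap: "\<And>i. i \<in> {1..d} \<Longrightarrow> \<delta> \<le> (r - 1) * (p i / r - p 0)"
    using adm by (auto simp: admissible_def)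
  define h where "h i = r powr S i" for i
  have h0: "0 < h i" for i using r by (simp add: h_def)
  have p1: "p i \<le> 1" if "i \<le> d" for i
  proof -
    have "p i \<le> (\<Sum>v\<le>d. p v)" using that p_pos by (intro member_le_sum) (auto simp: less_imp_le)
    then show ?thesis using p_sum by simp
  qed
  have mean: "(\<Sum>v\<le>d. p v * r powr (step b S v i)) \<le>
      (1 - \<delta>) * h i + (if i = 1 then of_bool b else h (i - 1))" if i: "i \<in> {1..d}" for i
  proof -
    have pi: "0 < p i" "p i \<le> 1" using i p_pos[of i] p1[of i] by auto
    have served: "p i * r powr (step b S i i) \<le> p i * (h i / r) + (if i = 1 then of_bool b else h (i - 1))"
    proof -
      have "r powr (step b S i i) \<le> h i / r + (if i = 1 then of_bool b else h (i - 1))"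
      proof (cases "i = 1 \<and> \<not> b")
        case True
        then show ?thesis using r by (simp add: step_def h_def powr_diff)
      next
        case False
        then have "r powr (step b S i i) \<le> r powr (S i - 1) + r powr (S (i - 1))"
          using i r by (auto simp: step_def max_def)
        also have "\<dots> = h i / r + (if i = 1 then of_bool b else h (i - 1))"
          using False r S0 by (auto simp: h_def powr_diff)
        finally show ?thesis .
      qed
      then have "p i * r powr (step b S i i) \<le> p i * (h i / r) + p i * (if i = 1 then of_bool b else h (i - 1))"
        using pi by (metis distrib_left mult_left_mono less_imp_le)
      also have "p i * (if i = 1 then of_bool b else h (i - 1)) \<le> 1 * (if i = 1 then of_bool b else h (i - 1))"
        using pi h0[of "i - 1"] by (intro mult_right_mono) auto
      finally show ?thesis by simp
    qed
    have "(\<Sum>v\<le>d. p v * r powr (step b S v i)) =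
        p 0 * (r * h i) + p i * r powr (step b S i i) + (1 - p 0 - p i) * h i"
      using sum_step[OF i, of "\<lambda>k. r powr k"] r by (simp add: h_def powr_add mult.commute)
    also have "\<dots> \<le> p 0 * (r * h i) + (p i * (h i / r) + (if i = 1 then of_bool b else h (i - 1)))
        + (1 - p 0 - p i) * h i"
      using served by simp
    also have "p 0 * (r * h i) + p i * (h i / r) + (1 - p 0 - p i) * h i
        = h i - h i * ((r - 1) * (p i / r - p 0))"
      using r by (simp add: field_simps)
    then have "p 0 * (r * h i) + (p i * (h i / r) + (if i = 1 then of_bool b else h (i - 1)))
        + (1 - p 0 - p i) * h i = h i - h i * ((r - 1) * (p i / r - p 0)) + (if i = 1 then of_bool b else h (i - 1))"
      by simp
    also have "\<dots> \<le> h i - h i * \<delta> + (if i = 1 then of_bool b else h (i - 1))"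
      using mult_left_mono[OF gap[OF i], of "h i"] h0[of i] by simp
    finally show ?thesis by (simp add: algebra_simps)
  qed
  have "(\<Sum>v\<le>d. p v * energy r c (step b S v)) =
      (\<Sum>i=1..d. c ^ i * (\<Sum>v\<le>d. p v * r powr (step b S v i)))"
    unfolding energy_def sum_distrib_left by (subst sum.swap) (simp add: mult.left_commute)
  also have "\<dots> \<le> (\<Sum>i=1..d. c ^ i * ((1 - \<delta>) * h i + (if i = 1 then of_bool b else h (i - 1))))"
    using c by (intro sum_mono mult_left_mono mean) auto
  also have "\<dots> = (1 - \<delta>) * energy r c S + (\<Sum>i=1..d. c ^ i * (if i = 1 then of_bool b else h (i - 1)))"
    by (simp add: distrib_left sum.distrib energy_def h_def sum_distrib_left mult.left_commute)
  also have "(\<Sum>i=1..d. c ^ i * (if i = 1 then of_bool b else h (i - 1)))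
      = c * of_bool b + (\<Sum>i=2..d. c ^ i * h (i - 1))"
    using d_pos by (simp add: sum.atLeast_Suc_atMost numeral_2_eq_2)
  also have "(\<Sum>i=2..d. c ^ i * h (i - 1)) = (\<Sum>i\<in>{1..d - 1}. c * (c ^ i * h i))"
    by (rule sum.reindex_bij_witness[of _ Suc "\<lambda>i. i - 1"]) (auto simp: power_eq_if)
  also have "\<dots> \<le> (\<Sum>i\<in>{1..d}. c * (c ^ i * h i))"
    using c h0 by (intro sum_mono2) (auto simp: less_imp_le)
  also have "\<dots> = c * energy r c S" by (simp add: energy_def h_def sum_distrib_left)
  finally have "(\<Sum>v\<le>d. p v * energy r c (step b S v)) \<le>
      (1 - \<delta> + c) * energy r c S + c * of_bool b"
    by (simp add: algebra_simps)
  also have "\<dots> \<le> (1 - \<delta> / 2) * energy r c S + of_bool b"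
    using c energy_nonneg[of c r S] by (intro add_mono mult_right_mono) auto
  finally show ?thesis .
qed

lemma ex_admissible:
  assumes "1 < r" "\<And>i. i \<in> {1..d} \<Longrightarrow> r * p 0 < p i"
  obtains \<delta> c where "admissible r \<delta> c"
proof
  define \<delta> where "\<delta> = Min ((\<lambda>i. (r - 1) * (p i / r - p 0)) ` {1..d})"
  have "0 < (r - 1) * (p i / r - p 0)" if "i \<in> {1..d}" for i
    using assms(1) assms(2)[OF that] by (intro mult_pos_pos) (auto simp: field_simps)
  then have "0 < \<delta>" unfolding \<delta>_def
    using d_pos by (subst Min_gr_iff) auto
  moreover have "\<delta> \<le> (r - 1) * (p i / r - p 0)" if "i \<in> {1..d}" for i
    unfolding \<delta>_def using that by (intro Min_le) auto
  ultimately show "admissible r \<delta> (min (\<delta> / 2) 1)"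
    using assms(1) by (auto simp: admissible_def)
qed


section \<open>Pathwise comparison\<close>

primrec win :: "int \<Rightarrow> (nat \<Rightarrow> int) \<Rightarrow> nat list \<Rightarrow> bool" where
  "win n S [] \<longleftrightarrow> S d = n"
| "win n S (v # w) \<longleftrightarrow> S d = n \<or> S d \<noteq> 0 \<and> win n (step True S v) w"

primrec hit :: "int \<Rightarrow> (nat \<Rightarrow> int) \<Rightarrow> nat list \<Rightarrow> bool" where
  "hit n R [] \<longleftrightarrow> R d = n"
| "hit n R (v # w) \<longleftrightarrow> R d = n \<or> hit n (step False R v) w"

text \<open>A relaxation of \<open>hit\<close> that is monotone in the starting state
  (\<open>exceed_mono\<close>). \<open>hit\<close> is not: a walk started above n may fail to come
  down to n.\<close>

primrec exceed :: "int \<Rightarrow> (nat \<Rightarrow> int) \<Rightarrow> nat list \<Rightarrow> bool" where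
  "exceed n R [] \<longleftrightarrow> n \<le> R d"
| "exceed n R (v # w) \<longleftrightarrow> n \<le> R d \<or> exceed n (step False R v) w"

primrec nonzero :: "(nat \<Rightarrow> int) \<Rightarrow> nat list \<Rightarrow> bool" where
  "nonzero S [] \<longleftrightarrow> S d \<noteq> 0"
| "nonzero S (v # w) \<longleftrightarrow> S d \<noteq> 0 \<and> nonzero (step True S v) w"

text \<open>A free walk started at 0, at some time up to the first emptying of X, reaches \<open>n\<close>.\<close>

primrec restart :: "int \<Rightarrow> (nat \<Rightarrow> int) \<Rightarrow> nat list \<Rightarrow> bool" where
  "restart n S [] \<longleftrightarrow> exceed n (\<lambda>_. 0) []"
| "restart n S (v # w) \<longleftrightarrow> exceed n (\<lambda>_. 0) (v # w) \<or> S d \<noteq> 0 \<and> restart n (step True S v) w"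

lemma exceed_imp_restart: "exceed n (\<lambda>_. 0) w \<Longrightarrow> restart n S w"
  by (cases w) auto

lemma exceed_ge: "n \<le> R d \<Longrightarrow> exceed n R w"
  by (cases w) auto

lemma hit_imp_exceed: "hit n R w \<Longrightarrow> exceed n R w"
  by (induction w arbitrary: R) auto

lemma step_mono:
  assumes "\<forall>i\<in>{1..d}. R i \<le> S i" "i \<in> {1..d}"
  shows "step False R v i \<le> step False S v i"
proof (cases "v = i \<and> i > 1")
  case False
  have "R i \<le> S i" using assms by blast
  with False show ?thesis using assms(2) by (auto simp: step_def)
next
  case True
  then have "i - 1 \<in> {1..d}" using assms by auto
  then have "R (i - 1) \<le> S (i - 1)" "R i \<le> S i" using assms by blast+
  then show ?thesis using True by (auto simp: step_def)
qed

lemma step_False_le_True: "step False S v i \<le> step True S v i"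
  by (auto simp: step_def)

lemma exceed_mono:
  assumes "\<forall>i\<in>{1..d}. R i \<le> S i" "exceed n R w"
  shows "exceed n S w"
  using assms
proof (induction w arbitrary: R S)
  case Nil
  then show ?case using d_pos by force
next
  case (Cons v w)
  show ?case
  proof (cases "n \<le> R d")
    case True
    then have "n \<le> S d" using Cons.prems(1) d_pos by force
    then show ?thesis by simp
  next
    case False
    then have "exceed n (step False R v) w" using Cons.prems by simp
    moreover have "\<forall>i\<in>{1..d}. step False R v i \<le> step False S v i"
      using step_mono[OF Cons.prems(1)] by blast
    ultimately have "exceed n (step False S v) w" by (rule Cons.IH[rotated])
    then show ?thesis by simp
  qed
qed

text \<open>What remains of \<open>queue_state\<close> for the free walk, whose first queue may be
  negative.\<close>

definition ordered :: "(nat \<Rightarrow> int) \<Rightarrow> bool" where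
  "ordered R \<longleftrightarrow> (\<forall>i\<in>{2..d}. R (i - 1) \<le> R i)"

lemma queue_state_ordered: "queue_state S \<Longrightarrow> ordered S"
  by (auto simp: queue_state_def ordered_def)

lemma ordered_step:
  assumes "ordered R"
  shows "ordered (step False R v)"
  unfolding ordered_def
proof
  fix i assume i: "i \<in> {2..d}"
  then have 1: "R (i - 1) \<le> R i" using assms by (auto simp: ordered_def)
  show "step False R v (i - 1) \<le> step False R v i"
  proof (cases "v = i - 1 \<and> v > 1")
    case True
    then have "v \<in> {2..d}" using i by auto
    then have "R (v - 1) \<le> R v" using assms unfolding ordered_def by blast
    then show ?thesis using True 1 i by (auto simp: step_def)
  qed (use i 1 in \<open>auto simp: step_def\<close>)
qed

lemma ordered_step_total_le:
  assumes "ordered R"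
  shows "step False R v d \<le> R d + 1"
proof (cases "v = d \<and> d > 1")
  case True
  then have "R (d - 1) \<le> R d" using assms by (auto simp: ordered_def)
  then show ?thesis using True by (auto simp: step_def)
qed (auto simp: step_def)

text \<open>From an ordered state the total rises by at most 1 per step, so n cannot be jumped over.
  In an unordered state a service at node d could lift S d to a larger S (d - 1).\<close>

lemma exceed_imp_hit:
  assumes "exceed n R w" "R d \<le> n" "ordered R"
  shows "hit n R w"
  using assms
proof (induction w arbitrary: R)
  case (Cons v w)
  show ?case
  proof (cases "R d = n")
    case False
    then have "step False R v d \<le> n"
      using ordered_step_total_le[OF Cons.prems(3), of v] Cons.prems(2) by linarith
    moreover have "exceed n (step False R v) w" using Cons.prems False by simp
    ultimately have "hit n (step False R v) w"
      using Cons.IH ordered_step[OF Cons.prems(3)] by blast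
    then show ?thesis by simp
  qed simp
qed simp

text \<open>The recursion for the partial sums is linear in the max-plus sense, and the boundary of
  node 1 contributes the value 0. So the constrained queue is the maximum of the free one
  and of free queues that were started empty at some earlier time.\<close>

lemma win_imp_exceed_or_restart:
  assumes "win n S w" "S 0 = 0" "\<forall>i\<in>{1..d}. \<exists>R\<in>F. S i \<le> R i"
  shows "(\<exists>R\<in>F. exceed n R w) \<or> restart n S w"
  using assms
proof (induction w arbitrary: S F)
  case Nil
  then obtain R where "R \<in> F" "S d \<le> R d" using d_pos by force
  then show ?case using Nil by auto
next
  case (Cons v w)
  show ?case
  proof (cases "S d = n")
    case True
    then obtain R where "R \<in> F" "S d \<le> R d" using Cons.prems d_pos by force
    then show ?thesis using True by auto
  next
    case False
    then have S: "S d \<noteq> 0" "win n (step True S v) w" using Cons.prems by auto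
    \<comment> \<open>All comparison walks advance, and one more starts from 0 now; it dominates
      coordinate 1 when the floor of node 1 is active. A family is carried along because different
      coordinates may be dominated by different walks.\<close>
    define F' where "F' = insert (\<lambda>_. 0) ((\<lambda>R. step False R v) ` F)"
    have dom: "\<exists>R\<in>F'. step True S v i \<le> R i" if i: "i \<in> {1..d}" for i
    proof -
      obtain R where R: "R \<in> F" "S i \<le> R i" using Cons.prems i by blast
      show ?thesis
      proof (cases "v = i")
        case False
        then have "step True S v i \<le> step False R v i" using R by (auto simp: step_def)
        then show ?thesis using R by (auto simp: F'_def)
      next
        case True
        show ?thesis
        proof (cases "S v - 1 \<le> S (v - 1)")
          case False
          then have "step True S v i \<le> step False R v i" using R True i by (auto simp: step_def)
          then show ?thesis using R by (auto simp: F'_def)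
        next
          case le: True
          show ?thesis
          proof (cases "v = 1")
            case True
            then show ?thesis using le \<open>v = i\<close> Cons.prems(2) by (auto simp: F'_def step_def)
          next
            case False
            then have "v - 1 \<in> {1..d}" using \<open>v = i\<close> i by auto
            \<comment> \<open>The floor of node v is active, so S v becomes S (v - 1), and the walk
              that dominates coordinate v - 1 now dominates coordinate v.\<close>
            then obtain R' where R': "R' \<in> F" "S (v - 1) \<le> R' (v - 1)" using Cons.prems by blast
            then have "step True S v i \<le> step False R' v i"
              using \<open>v = i\<close> False le i by (auto simp: step_def)
            then show ?thesis using R' by (auto simp: F'_def)
          qed
        qed
      qed
    qed
    have "step True S v 0 = 0" using Cons.prems(2) by (simp add: step_def)
    moreover have "\<forall>i\<in>{1..d}. \<exists>R\<in>F'. step True S v i \<le> R i" using dom by blast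
    ultimately have "(\<exists>R\<in>F'. exceed n R w) \<or> restart n (step True S v) w"
      by (rule Cons.IH[OF S(2)])
    then show ?thesis
      using S exceed_imp_restart by (auto simp: F'_def)
  qed
qed

text \<open>The free walk stays below X. If X empties before reaching n, the free walk is then at
  most 0 in every coordinate, and by monotonicity a walk started from 0 at that moment also gets to
  n.\<close>

lemma hit_imp_win_or_restart:
  assumes "exceed n R w" "queue_state S" "S d \<le> n" "\<forall>i\<in>{1..d}. R i \<le> S i"
  shows "win n S w \<or> restart n S w"
  using assms
proof (induction w arbitrary: R S)
  case Nil
  then have "R d \<le> S d" using d_pos by auto
  then show ?case using Nil by auto
next
  case (Cons v w)
  consider "S d = n" | "S d = 0" | "S d \<noteq> n" "S d \<noteq> 0" by blast
  then show ?case
  proof cases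
    case 2
    then have "\<forall>i\<in>{1..d}. R i \<le> 0"
      using Cons.prems(4) queue_state_empty[OF Cons.prems(2)] by fastforce
    then have "exceed n (\<lambda>_. 0) (v # w)"
      using exceed_mono[of R "\<lambda>_. 0" n "v # w"] Cons.prems(1) by simp
    then show ?thesis by simp
  next
    case 3
    have "R d \<le> S d" using Cons.prems(4) d_pos by auto
    then have "exceed n (step False R v) w" using 3 Cons.prems by auto
    moreover have "step True S v d \<le> n"
      using step_total_le[of S True v] 3 Cons.prems by auto
    moreover have "\<forall>i\<in>{1..d}. step False R v i \<le> step True S v i"
      using step_mono[OF Cons.prems(4)] step_False_le_True order_trans by blast
    ultimately have "win n (step True S v) w \<or> restart n (step True S v) w"
      by (rule Cons.IH[OF _ queue_state_step[OF Cons.prems(2)]])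
    then show ?thesis using 3 by auto
  next
    case 1
    then show ?thesis by simp
  qed
qed

lemma win_hit_differ_imp_restart:
  assumes "queue_state S" "S d \<le> n" "win n S w \<noteq> hit n S w"
  shows "restart n S w"
proof (cases "win n S w")
  case True
  have "exceed n S w \<or> restart n S w"
  proof -
    have "S 0 = 0" using assms(1) by (simp add: queue_state_def)
    then show ?thesis using win_imp_exceed_or_restart[OF True, of "{S}"] by simp
  qed
  moreover have "\<not> exceed n S w"
    using exceed_imp_hit[OF _ assms(2) queue_state_ordered[OF assms(1)]] True assms(3) by blast
  ultimately show ?thesis by blast
next
  case False
  then have "exceed n S w" using assms(3) hit_imp_exceed by simp
  then show ?thesis
    using False hit_imp_win_or_restart[OF _ assms(1,2)] by blast
qed

text \<open>The total drops by at most 1 per step, so from n or above it cannot reach 0 without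
  passing n.\<close>

lemma not_win_imp_nonzero:
  assumes "queue_state S" "n \<le> S d" "0 < n" "\<not> win n S w"
  shows "nonzero S w"
  using assms
proof (induction w arbitrary: S)
  case (Cons v w)
  then have "n \<le> step True S v d" using step_total_ge[of S True v] by auto
  moreover have "\<not> win n (step True S v) w" if "S d \<noteq> 0" using Cons.prems(4) that by simp
  ultimately show ?case
    using Cons.IH[OF queue_state_step[OF Cons.prems(1)]] Cons.prems(2,3) by auto
qed simp

text \<open>A free walk that starts at or above n and misses n remains above n, and X dominates
  it.\<close>

lemma not_hit_imp_nonzero:
  assumes "queue_state S" "n \<le> R d" "0 < n" "\<forall>i\<in>{1..d}. R i \<le> S i" "\<not> hit n R w"
  shows "nonzero S w"
  using assms
proof (induction w arbitrary: R S)
  case Nil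
  have "R d \<le> S d" using Nil.prems(4) d_pos by auto
  then show ?case using Nil.prems(2,3) by simp
next
  case (Cons v w)
  have "R d \<noteq> n" using Cons.prems(5) by simp
  then have "n \<le> step False R v d"
    using Cons.prems(2) step_total_ge[of R False v] by linarith
  moreover have "\<forall>i\<in>{1..d}. step False R v i \<le> step True S v i"
    using step_mono[OF Cons.prems(4)] step_False_le_True order_trans by blast
  moreover have "\<not> hit n (step False R v) w" using Cons.prems by simp
  ultimately have "nonzero (step True S v) w"
    using Cons.IH[OF queue_state_step[OF Cons.prems(1)] _ Cons.prems(3)] by blast
  moreover have "R d \<le> S d" using Cons.prems(4) d_pos by auto
  ultimately show ?case using Cons.prems(2,3) by simp
qed


section \<open>Probability estimates\<close>

text \<open>Optional stopping of the energy at the first time the total is n or more, where the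
  energy is at least c^d * r^n.\<close>

lemma word_mean_exceed_le:
  assumes "admissible r \<delta> c"
  shows "c ^ d * r powr n * word_mean k (\<lambda>w. of_bool (exceed n R w)) \<le> energy r c R"
proof (induction k arbitrary: R)
  have c: "0 < c" and r: "1 < r" and \<delta>: "0 < \<delta>" using assms by (auto simp: admissible_def)
  have above: "c ^ d * r powr n * word_mean k (\<lambda>w. of_bool (exceed n R w)) \<le> energy r c R"
    if "n \<le> R d" for k R
  proof -
    have "c ^ d * r powr n \<le> c ^ d * r powr R d"
      using that c r by (intro mult_left_mono powr_mono) auto
    also have "\<dots> \<le> energy r c R" using energy_ge_total[of c r R] c by simp
    finally show ?thesis using that by (simp add: exceed_ge)
  qed
  case 0
  show ?case using above[where k = 0 and R = R] energy_nonneg[of c r R] c by (cases "n \<le> R d") auto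
  case (Suc k)
  show ?case
  proof (cases "n \<le> R d")
    case True
    then show ?thesis by (rule above)
  next
    case False
    have "c ^ d * r powr n * word_mean (Suc k) (\<lambda>w. of_bool (exceed n R w)) =
        (\<Sum>v\<le>d. p v * (c ^ d * r powr n * word_mean k (\<lambda>w. of_bool (exceed n (step False R v) w))))"
      using False by (simp add: sum_distrib_left mult.left_commute)
    also have "\<dots> \<le> (\<Sum>v\<le>d. p v * energy r c (step False R v))"
      using p_pos by (intro sum_mono mult_left_mono Suc) (auto simp: less_imp_le)
    also have "\<dots> \<le> (1 - \<delta> / 2) * energy r c R"
      using energy_step[OF assms, of False R] by simp
    also have "\<dots> \<le> energy r c R"
      using energy_nonneg[of c r R] c \<delta> by (simp add: algebra_simps)
    finally show ?thesis .
  qed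
qed

text \<open>A union bound over the restart times. The restart at time 0 accounts for the 1; a
  restart at time u + 1 requires X to be nonempty at the times 0, ..., u, which is
  \<open>nonzero\<close> for a word of length u, and the letters after it are independent of
  that.\<close>

lemma word_mean_restart_le:
  assumes "\<And>k. word_mean k (\<lambda>w. of_bool (exceed n (\<lambda>_. 0) w)) \<le> h"
  shows "word_mean k (\<lambda>w. of_bool (restart n S w)) \<le>
    h * (1 + (\<Sum>u<k. word_mean u (\<lambda>w. of_bool (nonzero S w))))"
proof (induction k arbitrary: S)
  case 0
  show ?case using assms[of 0] by simp
next
  case (Suc k)
  have h: "0 \<le> h"
    by (rule order_trans[OF word_mean_nonneg assms[of 0]]) simp
  let ?nz = "\<lambda>S u. word_mean u (\<lambda>w. of_bool (nonzero S w))"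
  have nz_Suc: "?nz S (Suc u) = of_bool (S d \<noteq> 0) * (\<Sum>v\<le>d. p v * ?nz (step True S v) u)" for u
    by simp
  have "word_mean (Suc k) (\<lambda>w. of_bool (restart n S w)) \<le>
      word_mean (Suc k) (\<lambda>w. of_bool (exceed n (\<lambda>_. 0) w) +
        of_bool (S d \<noteq> 0 \<and> restart n (step True S (hd w)) (tl w)))"
    by (intro word_mean_mono) (auto simp: neq_Nil_conv length_Suc_conv)
  also have "\<dots> = word_mean (Suc k) (\<lambda>w. of_bool (exceed n (\<lambda>_. 0) w)) +
      of_bool (S d \<noteq> 0) * (\<Sum>v\<le>d. p v * word_mean k (\<lambda>w. of_bool (restart n (step True S v) w)))"
    unfolding word_mean_add by simp
  also have "\<dots> \<le> h + of_bool (S d \<noteq> 0) *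
      (\<Sum>v\<le>d. p v * (h * (1 + (\<Sum>u<k. ?nz (step True S v) u))))"
    using p_pos by (intro add_mono assms mult_left_mono sum_mono Suc) (auto simp: less_imp_le)
  also have "(\<Sum>v\<le>d. p v * (h * (1 + (\<Sum>u<k. ?nz (step True S v) u)))) =
      h * ((\<Sum>v\<le>d. p v) + (\<Sum>v\<le>d. \<Sum>u<k. p v * ?nz (step True S v) u))"
    by (simp add: sum_distrib_left sum.distrib algebra_simps)
  also have "(\<Sum>v\<le>d. \<Sum>u<k. p v * ?nz (step True S v) u) = (\<Sum>u<k. \<Sum>v\<le>d. p v * ?nz (step True S v) u)"
    by (rule sum.swap)
  also have "h + of_bool (S d \<noteq> 0) * (h * ((\<Sum>v\<le>d. p v) + \<dots>)) =
     h * (1 + (of_bool (S d \<noteq> 0) + (\<Sum>u<k. ?nz S (Suc u))))"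
    unfolding nz_Suc p_sum by (simp add: algebra_simps sum_distrib_left)
  also have "of_bool (S d \<noteq> 0) + (\<Sum>u<k. ?nz S (Suc u)) = (\<Sum>u<Suc k. ?nz S u)"
    by (subst sum.lessThan_Suc_shift) simp
  finally show ?case .
qed

section \<open>The expected time until X empties\<close>

lemma nonzero_append: "nonzero S (w @ w') \<longleftrightarrow> nonzero S w \<and> nonzero (foldl (step True) S w) w'"
  by (induction w arbitrary: S) (cases w', auto)

lemma queue_state_foldl: "queue_state S \<Longrightarrow> queue_state (foldl (step True) S w)"
  by (induction w arbitrary: S) (auto simp: queue_state_step)

text \<open>The sum of the S i counts the services still needed: a customer at node j counts d - j +
  1 times. While some node is nonempty, serving it lowers the sum by 1. Once X is empty the word is
  padded with arbitrary letters, since \<open>nonzero\<close> only asks about the time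
  before.\<close>

lemma ex_emptying_word:
  assumes "queue_state S" "(\<Sum>i=1..d. S i) \<le> int m"
  shows "\<exists>w. length w = m \<and> set w \<subseteq> {..d} \<and> \<not> nonzero S w"
  using assms
proof (induction m arbitrary: S)
  case 0
  have "S d \<le> (\<Sum>i=1..d. S i)"
    using queue_state_nonneg[OF 0(1)] d_pos by (intro member_le_sum) auto
  then show ?case using 0 queue_state_nonneg[OF 0(1), of d] by auto
next
  case (Suc m)
  show ?case
  proof (cases "S d = 0")
    case True
    then show ?thesis by (intro exI[of _ "replicate (Suc m) 0"]) auto
  next
    case False
    have "\<exists>v\<in>{1..d}. S (v - 1) < S v"
    proof (rule ccontr)
      assume "\<not> ?thesis"
      then have "\<forall>v\<in>{1..d}. S v \<le> S (v - 1)" by auto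
      then have "S i \<le> 0" if "i \<le> d" for i
        using that Suc.prems(1) by (induction i) (force simp: queue_state_def)+
      then show False using False queue_state_nonneg[OF Suc.prems(1), of d] by force
    qed
    then obtain v where v: "v \<in> {1..d}" "S (v - 1) < S v" by blast
    have "step True S v i = S i - of_bool (i = v)" if "i \<in> {1..d}" for i
      using v that by (auto simp: step_def)
    then have "(\<Sum>i=1..d. step True S v i) = (\<Sum>i=1..d. S i) - 1"
      using v by (simp add: sum_subtractf of_bool_def)
    then have "(\<Sum>i=1..d. step True S v i) \<le> int m" using Suc.prems(2) by simp
    then obtain w where "length w = m" "set w \<subseteq> {..d}" "\<not> nonzero (step True S v) w"
      using Suc.IH[OF queue_state_step[OF Suc.prems(1)]] by blast
    then show ?thesis using v by (intro exI[of _ "v # w"]) auto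
  qed
qed

text \<open>Foster's argument, with the exceptional set of small energy, from which the system empties
  within \<open>m\<close> steps with probability at least \<open>e\<close>. Here \<open>a u\<close> and \<open>b u\<close> are the probability that X has
  not emptied by time \<open>u\<close> and the mean energy on that event.\<close>

lemma sum_nonzero_le:
  assumes adm: "admissible r \<delta> c"
  obtains C where "\<And>S T. queue_state S \<Longrightarrow>
    (\<Sum>u<T. word_mean u (\<lambda>w. of_bool (nonzero S w))) \<le> C + energy r c S"
proof -
  have c: "0 < c" and r: "1 < r" and \<delta>: "0 < \<delta>" using adm by (auto simp: admissible_def)
  \<comment> \<open>Chosen so that \<delta> / 2 * B \<le> b 0 + A below becomes B / \<kappa> \<le>
    (b 0 + A) / 2, which leaves half of A to be absorbed on the left.\<close>
  define \<kappa> where "\<kappa> = 4 / \<delta>"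
  have \<kappa>: "0 < \<kappa>" using \<delta> by (simp add: \<kappa>_def)
  \<comment> \<open>Energy at most \<kappa> keeps the total below N, hence the sum of the d partial
    sums at most m = d * N, and some word of length m empties X.\<close>
  obtain N where N: "\<kappa> / c ^ d < r ^ N" using real_arch_pow[OF r] by blast
  define m where "m = d * N"
  have small: "(\<Sum>i=1..d. S i) \<le> int m" if S: "queue_state S" "energy r c S \<le> \<kappa>" for S
  proof -
    have "c ^ d * r powr S d \<le> \<kappa>" using energy_ge_total[of c r S] c S by simp
    then have "r powr S d \<le> \<kappa> / c ^ d" using c by (simp add: field_simps)
    also have "\<dots> < r powr real N" using N r by (simp add: powr_realpow)
    finally have "S d < int N" using r by (simp add: powr_less_cancel_iff)
    then have "(\<Sum>i=1..d. S i) \<le> (\<Sum>i=1..d. int N)"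
      using queue_state_mono[OF S(1), of _ d] by (intro sum_mono) force
    then show ?thesis by (simp add: m_def)
  qed
  define q where "q = Min (p ` {..d})"
  have q: "0 < q" "\<And>v. v \<le> d \<Longrightarrow> q \<le> p v"
    using p_pos by (auto simp: q_def)
  define e where "e = q ^ m"
  have e: "0 < e" using q by (simp add: e_def)
  show ?thesis
  proof (rule that)
    fix S T assume S: "queue_state S"
    define E where "E w = energy r c (foldl (step True) S w)" for w
    define a where "a u = word_mean u (\<lambda>w. of_bool (nonzero S w))" for u
    define b where "b u = word_mean u (\<lambda>w. of_bool (nonzero S w) * E w)" for u
    have E0: "0 \<le> E w" for w unfolding E_def using c by (intro energy_nonneg) simp
    have a01: "0 \<le> a u" "a u \<le> 1" for u
      unfolding a_def by (intro word_mean_nonneg word_mean_le_const, simp)+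
    have b0: "0 \<le> b u" for u
      unfolding b_def using E0 by (intro word_mean_nonneg) simp
    have b_Suc: "b (Suc u) \<le> (1 - \<delta> / 2) * b u + a u" for u
    proof -
      have "b (Suc u) = word_mean u (\<lambda>w. \<Sum>v\<le>d. p v * (of_bool (nonzero S (w @ [v])) * E (w @ [v])))"
        unfolding b_def by (rule word_mean_Suc_snoc)
      also have "\<dots> \<le> word_mean u (\<lambda>w. (1 - \<delta> / 2) * (of_bool (nonzero S w) * E w) + of_bool (nonzero S w))"
      proof (rule word_mean_mono)
        fix w :: "nat list"
        have "queue_state (foldl (step True) S w)" by (rule queue_state_foldl[OF S])
        then have E_step: "(\<Sum>v\<le>d. p v * E (w @ [v])) \<le> (1 - \<delta> / 2) * E w + 1"
          unfolding E_def using energy_step[OF adm, of True "foldl (step True) S w"]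
          by (simp add: queue_state_def)
        have "(\<Sum>v\<le>d. p v * (of_bool (nonzero S (w @ [v])) * E (w @ [v]))) \<le>
            (\<Sum>v\<le>d. p v * (of_bool (nonzero S w) * E (w @ [v])))"
          using p_pos E0
          by (intro sum_mono mult_left_mono mult_right_mono) (auto simp: nonzero_append less_imp_le)
        also have "\<dots> = of_bool (nonzero S w) * (\<Sum>v\<le>d. p v * E (w @ [v]))"
          by (simp add: sum_distrib_left mult.left_commute)
        also have "\<dots> \<le> (1 - \<delta> / 2) * (of_bool (nonzero S w) * E w) + of_bool (nonzero S w)"
          using E_step by simp
        finally show "(\<Sum>v\<le>d. p v * (of_bool (nonzero S (w @ [v])) * E (w @ [v]))) \<le>
          (1 - \<delta> / 2) * (of_bool (nonzero S w) * E w) + of_bool (nonzero S w)" .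
      qed
      finally show ?thesis unfolding word_mean_add word_mean_cmult a_def b_def .
    qed
    \<comment> \<open>Given the state at time u, X survives m more steps with probability at most 1
      - e if E \<le> \<kappa>, and trivially at most 1 if E > \<kappa>. The single bound 1 - e + e *
      E / \<kappa> covers both cases, as in Markov's inequality.\<close>
    have a_shift: "a (u + m) \<le> a u - e * (a u - b u / \<kappa>)" for u
    proof -
      have "a (u + m) = word_mean u (\<lambda>w. word_mean m (\<lambda>w'. of_bool (nonzero S (w @ w'))))"
        unfolding a_def by (rule word_mean_append)
      also have "\<dots> \<le> word_mean u (\<lambda>w. of_bool (nonzero S w) -
          (e * of_bool (nonzero S w) - e / \<kappa> * (of_bool (nonzero S w) * E w)))"
      proof (rule word_mean_mono)
        fix w :: "nat list"
        let ?S = "foldl (step True) S w"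
        have qs: "queue_state ?S" by (rule queue_state_foldl[OF S])
        have "word_mean m (\<lambda>w'. of_bool (nonzero ?S w')) \<le> 1 - e + e / \<kappa> * E w"
        proof (cases "E w \<le> \<kappa>")
          case True
          then obtain w' where "length w' = m" "set w' \<subseteq> {..d}" "\<not> nonzero ?S w'"
            using ex_emptying_word[OF qs small[OF qs]] by (auto simp: E_def)
          then have "word_mean m (\<lambda>w'. of_bool (nonzero ?S w')) \<le> 1 - q ^ m"
            using q by (intro word_mean_missing_word[of _ w']) (auto simp: less_imp_le)
          moreover have "0 \<le> e / \<kappa> * E w" using e \<kappa> E0 by simp
          ultimately show ?thesis by (simp add: e_def)
        next
          case False
          then have "e \<le> e / \<kappa> * E w" using e \<kappa> by (simp add: field_simps)
          moreover have "word_mean m (\<lambda>w'. of_bool (nonzero ?S w')) \<le> 1"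
            by (intro word_mean_le_const) simp
          ultimately show ?thesis by simp
        qed
        then show "word_mean m (\<lambda>w'. of_bool (nonzero S (w @ w'))) \<le>
          of_bool (nonzero S w) - (e * of_bool (nonzero S w) - e / \<kappa> * (of_bool (nonzero S w) * E w))"
          by (cases "nonzero S w") (simp_all add: nonzero_append)
      qed
      finally show ?thesis
        unfolding word_mean_diff word_mean_cmult a_def b_def by (simp add: algebra_simps)
    qed
    \<comment> \<open>Summed over u < T, the two recursions become two linear inequalities between
      the finite numbers A and B, with constants that do not depend on T.\<close>
    define A where "A = (\<Sum>u<T. a u)"
    define B where "B = (\<Sum>u<T. b u)"
    have "B - b 0 \<le> (\<Sum>u<T. b (Suc u))"
    proof -
      have "(\<Sum>u<Suc T. b u) = b 0 + (\<Sum>u<T. b (Suc u))" by (rule sum.lessThan_Suc_shift)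
      then show ?thesis using b0[of T] by (simp add: B_def)
    qed
    also have "\<dots> \<le> (\<Sum>u<T. (1 - \<delta> / 2) * b u + a u)" by (intro sum_mono b_Suc)
    also have "\<dots> = (1 - \<delta> / 2) * B + A" by (simp add: A_def B_def sum.distrib sum_distrib_left)
    finally have B: "\<delta> / 2 * B \<le> b 0 + A" by (simp add: algebra_simps)
    have "A - real m \<le> (\<Sum>u<T. a (u + m))"
    proof -
      have "A \<le> (\<Sum>u<m + T. a u)" unfolding A_def using a01 by (intro sum_mono2) auto
      also have "\<dots> = (\<Sum>u<m. a u) + (\<Sum>u<T. a (u + m))"
        by (induction T) (simp_all add: add.commute)
      also have "(\<Sum>u<m. a u) \<le> (\<Sum>u<m. 1)" using a01 by (intro sum_mono) auto
      finally show ?thesis by simp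
    qed
    also have "\<dots> \<le> (\<Sum>u<T. a u - e * (a u - b u / \<kappa>))" by (intro sum_mono a_shift)
    also have "\<dots> = A - e * (A - B / \<kappa>)"
      by (simp add: A_def B_def sum_subtractf sum_distrib_left right_diff_distrib sum_divide_distrib)
    finally have "A \<le> real m / e + B / \<kappa>" using e by (simp add: field_simps)
    also have "B / \<kappa> = (\<delta> / 2 * B) / 2" by (simp add: \<kappa>_def)
    also have "\<dots> \<le> (b 0 + A) / 2" by (rule divide_right_mono[OF B]) simp
    also have "b 0 \<le> energy r c S" using E0[of "[]"] by (auto simp: b_def E_def)
    finally have "A \<le> real m / e + (energy r c S + A) / 2" by simp
    moreover have "A \<le> 2 * y + E" if "A \<le> y + (E + A) / 2" for y E using that by (simp add: field_simps)
    ultimately have "A \<le> 2 * (real m / e) + energy r c S" by blast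
    then show "(\<Sum>u<T. word_mean u (\<lambda>w. of_bool (nonzero S w))) \<le> 2 * (real m / e) + energy r c S"
      by (simp only: A_def a_def)
  qed
qed

text \<open>The tail probabilities of the emptying time have bounded partial sums, hence tend to 0.
  Any r above 1 and below every p i / p 0 serves; midpoints between 1 and these ratios, capped at 2,
  are such a choice.\<close>

lemma nonzero_tendsto_0:
  assumes "queue_state S"
  shows "(\<lambda>T. word_mean T (\<lambda>w. of_bool (nonzero S w))) \<longlonglongrightarrow> 0"
proof -
  define r where "r = Min (insert 2 ((\<lambda>i. (1 + p i / p 0) / 2) ` {1..d}))"
  have p0: "0 < p 0" using p_pos[of 0] by simp
  have "1 < r" unfolding r_def using stable p0 by (subst Min_gr_iff) auto
  moreover have "r * p 0 < p i" if "i \<in> {1..d}" for i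
  proof -
    have "r \<le> (1 + p i / p 0) / 2" unfolding r_def using that by (intro Min_le) auto
    then have "r * p 0 \<le> (1 + p i / p 0) / 2 * p 0" using p0 by (intro mult_right_mono) auto
    also have "\<dots> < p i" using stable[OF that] p0 by (simp add: field_simps)
    finally show ?thesis .
  qed
  ultimately obtain \<delta> c where "admissible r \<delta> c" by (rule ex_admissible)
  then obtain C where C: "\<And>T. (\<Sum>u<T. word_mean u (\<lambda>w. of_bool (nonzero S w))) \<le> C + energy r c S"
    using sum_nonzero_le assms by metis
  have "summable (\<lambda>u. word_mean u (\<lambda>w. of_bool (nonzero S w)))"
    using C by (intro summableI_nonneg_bounded word_mean_nonneg) auto
  then show ?thesis by (rule summable_LIMSEQ_zero)
qed

text \<open>For r = p i / p 0 arrivals and services at node i balance, since p 0 * r = p i and p i /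
  r = p 0; the floor can only raise r^(S i), so it is a submartingale. It is at most r^n while the
  total is at most n and equals 1 when X is empty. The paths not emptied within k steps are charged
  r^n as well.\<close>

lemma win_lower_bound:
  assumes S: "queue_state S" "S d \<le> n" and i: "i \<in> {1..d}"
  defines "r \<equiv> p i / p 0"
  shows "r powr S i \<le> r powr n * (word_mean k (\<lambda>w. of_bool (win n S w)) +
    word_mean k (\<lambda>w. of_bool (nonzero S w))) + 1"
  using S
proof (induction k arbitrary: S)
  have r: "1 < r" unfolding r_def using stable[OF i] p_pos[of 0] by simp
  have ge0: "0 \<le> word_mean k (\<lambda>w. of_bool (win n S w))" "0 \<le> word_mean k (\<lambda>w. of_bool (nonzero S w))"
    for k S by (auto intro: word_mean_nonneg)
  have at_n: "r powr S i \<le> r powr n * (word_mean k (\<lambda>w. of_bool (win n S w)) +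
    word_mean k (\<lambda>w. of_bool (nonzero S w))) + 1" if "queue_state S" "S d = n" for S k
  proof -
    have "win n S w" for w using that by (cases w) auto
    moreover have "r powr S i \<le> r powr n"
      using that r i queue_state_mono[OF that(1), of i d] by (auto intro!: powr_mono)
    ultimately show ?thesis using ge0(2)[of k S] by (simp add: distrib_left add_increasing2)
  qed
  have at_0: "r powr S i \<le> r powr n * (word_mean k (\<lambda>w. of_bool (win n S w)) +
    word_mean k (\<lambda>w. of_bool (nonzero S w))) + 1" if "queue_state S" "S d = 0" for S k
  proof -
    have "S i = 0" using queue_state_empty[OF that] i by auto
    then show ?thesis using ge0[of k S] r by simp
  qed
  case 0
  have "r powr S i \<le> r powr n"
    using 0 r i queue_state_mono[OF 0(1), of i d] by (auto intro!: powr_mono)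
  then have "r powr S i \<le> r powr n * 2 + 1" using powr_ge_zero[of r n] by linarith
  then show ?case using \<open>r powr S i \<le> r powr n\<close> using at_0[OF 0(1), of 0] by (cases "S d = 0") (auto split: if_splits)
  case (Suc k)
  consider "S d = n" | "S d = 0" | "S d \<noteq> n" "S d \<noteq> 0" by blast
  then show ?case
  proof cases
    case 3
    let ?R = "\<lambda>v. word_mean k (\<lambda>w. of_bool (win n (step True S v) w)) +
      word_mean k (\<lambda>w. of_bool (nonzero (step True S v) w))"
    have p: "0 < p 0" "0 < p i" using p_pos[of 0] p_pos[of i] i by auto
    have "r powr S i = p 0 * r powr (S i + 1) + p i * r powr (S i - 1) + (1 - p 0 - p i) * r powr S i"
    proof -
      have "p 0 * r powr (S i + 1) = p i * r powr S i" using p by (simp add: powr_add r_def)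
      moreover have "p i * r powr (S i - 1) = p 0 * r powr S i"
        using p by (simp add: powr_diff r_def)
      ultimately show ?thesis by (simp add: algebra_simps)
    qed
    also have "\<dots> \<le> p 0 * r powr (S i + 1) + p i * r powr (step True S i i) + (1 - p 0 - p i) * r powr S i"
      using p r i by (auto intro!: mult_left_mono powr_mono simp: step_def)
    also have "\<dots> = (\<Sum>v\<le>d. p v * r powr (step True S v i))"
      using sum_step[OF i, of "\<lambda>k. r powr k" True S] by simp
    also have "\<dots> \<le> (\<Sum>v\<le>d. p v * (r powr n * ?R v + 1))"
    proof (intro sum_mono mult_left_mono)
      fix v assume "v \<in> {..d}"
      show "r powr (step True S v i) \<le> r powr n * ?R v + 1"
        using step_total_le[of S True v] Suc.prems 3 queue_state_step by (intro Suc.IH) auto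
      show "0 \<le> p v" using \<open>v \<in> {..d}\<close> p_pos by (auto simp: less_imp_le)
    qed
    also have "\<dots> = r powr n * (\<Sum>v\<le>d. p v * ?R v) + 1"
      by (simp add: distrib_left sum.distrib sum_distrib_left p_sum mult.left_commute)
    also have "(\<Sum>v\<le>d. p v * ?R v) = word_mean (Suc k) (\<lambda>w. of_bool (win n S w)) +
        word_mean (Suc k) (\<lambda>w. of_bool (nonzero S w))"
      using 3 by (simp add: distrib_left sum.distrib)
    finally show ?thesis .
  next
    case 1
    with Suc.prems(1) show ?thesis by (rule at_n)
  next
    case 2
    with Suc.prems(1) show ?thesis by (rule at_0)
  qed
qed


section \<open>The estimates in terms of \<rho>\<close>

definition load :: real where
  "load = Max ((\<lambda>i. p 0 / p i) ` {1..d})"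

lemma load_ge: "i \<in> {1..d} \<Longrightarrow> p 0 / p i \<le> load"
  unfolding load_def by (intro Max_ge) auto

lemma load_less_1: "load < 1"
  unfolding load_def using d_pos stable p_pos by (subst Max_less_iff) (auto simp: field_simps)

lemma load_pos: "0 < load"
proof -
  have "0 < p 0 / p 1" using p_pos[of 0] p_pos[of 1] d_pos by simp
  also have "\<dots> \<le> load" using d_pos by (intro load_ge) auto
  finally show ?thesis .
qed

text \<open>1 / \<open>load\<close> is the smallest of the ratios p i / p 0, and
  \<open>load\<close>^(-x) lies strictly between 1 and 1 / \<open>load\<close>.\<close>

lemma ex_admissible_load:
  fixes x :: real
  assumes "0 < x" "x < 1"
  obtains \<delta> c where "admissible (load powr (- x)) \<delta> c"
proof (rule ex_admissible)
  show "1 < load powr (- x)"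
    using powr_less_mono'[of load 0 x] assms load_pos load_less_1
    by (simp add: powr_minus one_less_inverse_iff)
next
  fix i assume i: "i \<in> {1..d}"
  then have p: "0 < p 0" "0 < p i" using p_pos[of 0] p_pos[of i] by auto
  have "load powr 1 < load powr x" using assms load_pos load_less_1 by (intro powr_less_mono') auto
  then have "p 0 / p i < load powr x" using load_ge[OF i] load_pos by simp
  then show "load powr (- x) * p 0 < p i" using p load_pos by (simp add: powr_minus field_simps)
qed

lemma win_hit_difference_le:
  fixes \<epsilon> :: real
  assumes "0 < \<epsilon>" "\<epsilon> < 1"
  obtains C where "0 < C" "\<And>n S k. queue_state S \<Longrightarrow> S d \<le> int n \<Longrightarrow>
    \<bar>word_mean k (\<lambda>w. of_bool (win n S w)) - word_mean k (\<lambda>w. of_bool (hit n S w))\<bar>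
      \<le> C * load powr (n * (1 - \<epsilon>))"
proof -
  \<comment> \<open>This r bounds the chance of reaching n from 0; the next one, closer to 1 as
    \<epsilon> shrinks, bounds the number of restarts.\<close>
  obtain \<delta> c where adm: "admissible (load powr (- (1 - \<epsilon> / 2))) \<delta> c"
    using assms by (rule_tac ex_admissible_load[of "1 - \<epsilon> / 2"]) auto
  obtain \<delta>' c' where adm': "admissible (load powr (- (\<epsilon> / 2))) \<delta>' c'"
    using assms by (rule_tac ex_admissible_load[of "\<epsilon> / 2"]) auto
  obtain D where D: "\<And>S T. queue_state S \<Longrightarrow>
    (\<Sum>u<T. word_mean u (\<lambda>w. of_bool (nonzero S w))) \<le> D + energy (load powr (- (\<epsilon> / 2))) c' S"
    using sum_nonzero_le[OF adm'] by metis
  have c: "0 < c" "c \<le> 1" using adm by (auto simp: admissible_def)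
  have c': "0 < c'" "c' \<le> 1" "1 \<le> load powr (- (\<epsilon> / 2))" using adm' by (auto simp: admissible_def)
  \<comment> \<open>The zero state has energy at most d and reaching n needs c^d * r^n, which gives
    d / c^d. The last factor turns 1 + D + d * Z into a multiple of Z, as Z \<ge> 1.\<close>
  define C where "C = real d / c ^ d * (1 + \<bar>D\<bar> + real d)"
  show ?thesis
  proof (rule that)
    show "0 < C" unfolding C_def using d_pos c by simp
    fix n k :: nat and S assume S: "queue_state S" "S d \<le> int n"
    define h where "h = real d / c ^ d * load powr (n * (1 - \<epsilon> / 2))"
    define Z where "Z = load powr (- (\<epsilon> / 2) * n)"
    have h: "0 \<le> h" unfolding h_def using c by simp
    have "word_mean k (\<lambda>w. of_bool (exceed (int n) (\<lambda>_. 0) w)) \<le> h" for k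
    proof -
      have "c ^ d * load powr (- (1 - \<epsilon> / 2) * n) * word_mean k (\<lambda>w. of_bool (exceed (int n) (\<lambda>_. 0) w))
          \<le> energy (load powr (- (1 - \<epsilon> / 2))) c (\<lambda>_. 0)"
        using word_mean_exceed_le[OF adm, of "int n" k "\<lambda>_. 0"] by (simp add: powr_powr)
      also have "\<dots> \<le> real d * (load powr (- (1 - \<epsilon> / 2))) powr real_of_int 0"
        using c adm by (intro energy_le) (auto simp: admissible_def)
      also have "\<dots> = real d" using load_pos by simp
      finally have "word_mean k (\<lambda>w. of_bool (exceed (int n) (\<lambda>_. 0) w)) \<le>
          real d / (c ^ d * load powr (- (1 - \<epsilon> / 2) * n))"
        using c load_pos by (simp add: pos_le_divide_eq mult.commute)
      also have "\<dots> = h"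
      proof -
        have "- (1 - \<epsilon> / 2) * n = - (n * (1 - \<epsilon> / 2))" by (simp add: algebra_simps)
        then have "load powr (- (1 - \<epsilon> / 2) * n) = inverse (load powr (n * (1 - \<epsilon> / 2)))"
          by (simp only: powr_minus)
        then show ?thesis
          by (simp only: h_def divide_inverse inverse_mult_distrib inverse_inverse_eq mult.assoc)
      qed
      finally show ?thesis .
    qed
    then have "word_mean k (\<lambda>w. of_bool (restart n S w)) \<le>
        h * (1 + (\<Sum>u<k. word_mean u (\<lambda>w. of_bool (nonzero S w))))"
      by (rule word_mean_restart_le)
    also have "\<dots> \<le> h * ((1 + \<bar>D\<bar> + real d) * Z)"
    proof (rule mult_left_mono[OF _ h])
      have "energy (load powr (- (\<epsilon> / 2))) c' S \<le> real d * (load powr (- (\<epsilon> / 2))) powr real_of_int (int n)"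
        using c' S queue_state_mono[OF S(1), of _ d] by (intro energy_le) force+
      also have "\<dots> = real d * load powr (- (\<epsilon> / 2) * n)" by (simp add: powr_powr)
      finally have en: "energy (load powr (- (\<epsilon> / 2))) c' S \<le> real d * Z" by (simp only: Z_def)
      have "1 \<le> Z"
        using ge_one_powr_ge_zero[OF c'(3), of "real n"] unfolding Z_def powr_powr by simp
      then have "(1 + \<bar>D\<bar>) * 1 \<le> (1 + \<bar>D\<bar>) * Z" by (intro mult_left_mono) auto
      moreover have "1 + (\<Sum>u<k. word_mean u (\<lambda>w. of_bool (nonzero S w))) \<le> (1 + \<bar>D\<bar>) * 1 + real d * Z"
        using D[OF S(1), of k] en abs_ge_self[of D] by simp
      ultimately show "1 + (\<Sum>u<k. word_mean u (\<lambda>w. of_bool (nonzero S w))) \<le> (1 + \<bar>D\<bar> + real d) * Z"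
        by (simp add: distrib_right)
    qed
    also have "\<dots> = C * (load powr (n * (1 - \<epsilon> / 2)) * Z)"
      by (simp add: C_def h_def)
    also have "load powr (n * (1 - \<epsilon> / 2)) * Z = load powr (n * (1 - \<epsilon>))"
    proof -
      have "n * (1 - \<epsilon> / 2) + - (\<epsilon> / 2) * n = n * (1 - \<epsilon>)" by (simp add: algebra_simps)
      then show ?thesis by (simp only: Z_def powr_add[symmetric])
    qed
    finally have restart: "word_mean k (\<lambda>w. of_bool (restart n S w)) \<le> C * load powr (n * (1 - \<epsilon>))" .
    have "word_mean k (\<lambda>w. of_bool (win n S w)) \<le>
        word_mean k (\<lambda>w. of_bool (hit n S w) + of_bool (restart n S w))"
      "word_mean k (\<lambda>w. of_bool (hit n S w)) \<le>
        word_mean k (\<lambda>w. of_bool (win n S w) + of_bool (restart n S w))"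
      using win_hit_differ_imp_restart[OF S] by (auto intro!: word_mean_mono)
    then show "\<bar>word_mean k (\<lambda>w. of_bool (win n S w)) - word_mean k (\<lambda>w. of_bool (hit n S w))\<bar>
      \<le> C * load powr (n * (1 - \<epsilon>))"
      unfolding word_mean_add using restart by linarith
  qed
qed

text \<open>The undecided mass in \<open>win_lower_bound\<close> vanishes in the limit. Its additive
  1 costs only the factor 1 - \<open>load\<close>: S i \<ge> 1 and 1 / r \<le> \<open>load\<close>
  give 1 \<le> \<open>load\<close> * r^(S i).\<close>

lemma win_limit_ge:
  assumes lim: "(\<lambda>k. word_mean k (\<lambda>w. of_bool (win n S w))) \<longlonglongrightarrow> P"
    and S: "queue_state S" "S d \<le> n" and i: "i \<in> {1..d}" "1 \<le> S i"
  shows "(1 - load) * (p 0 / p i) powr (n - S i) \<le> P"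
proof -
  define r where "r = p i / p 0"
  have r: "1 < r" unfolding r_def using stable[OF i(1)] p_pos[of 0] by simp
  have "(\<lambda>k. r powr n * (word_mean k (\<lambda>w. of_bool (win n S w)) +
    word_mean k (\<lambda>w. of_bool (nonzero S w))) + 1) \<longlonglongrightarrow> r powr n * (P + 0) + 1"
    by (intro tendsto_intros lim nonzero_tendsto_0 S)
  then have "r powr S i \<le> r powr n * (P + 0) + 1"
    by (rule LIMSEQ_le_const) (use win_lower_bound[OF S i(1)] in \<open>auto simp: r_def\<close>)
  then have "r powr S i - 1 \<le> r powr n * P" by simp
  moreover have "(1 - load) * r powr S i \<le> r powr S i - 1"
  proof -
    have "1 / r \<le> load" using load_ge[OF i(1)] by (simp add: r_def)
    then have "1 \<le> load * r" using r by (simp add: field_simps)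
    also have "load * r \<le> load * r powr S i"
      using load_pos r i(2) powr_mono[of 1 "S i" r] by (intro mult_left_mono) auto
    finally show ?thesis by (simp add: algebra_simps)
  qed
  ultimately have "(1 - load) * (r powr S i / r powr n) \<le> P"
    using r by (simp add: field_simps)
  moreover have "(p 0 / p i) powr (n - S i) = r powr S i / r powr n"
  proof -
    have "p 0 / p i = inverse r" by (simp add: r_def)
    then have "(p 0 / p i) powr (n - S i) = r powr (- real_of_int (n - S i))"
      by (simp add: inverse_powr flip: powr_minus)
    then show ?thesis using r by (simp add: powr_diff)
  qed
  ultimately show ?thesis by simp
qed

lemma limit_eq_1_of_not_imp_nonzero:
  assumes "queue_state S" "\<And>w. \<not> Q w \<Longrightarrow> nonzero S w"
  shows "(\<lambda>k. word_mean k (\<lambda>w. of_bool (Q w))) \<longlonglongrightarrow> 1"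
proof (rule tendsto_sandwich)
  show "(\<lambda>k. 1 - word_mean k (\<lambda>w. of_bool (nonzero S w))) \<longlonglongrightarrow> 1"
    using tendsto_diff[OF tendsto_const nonzero_tendsto_0[OF assms(1)], of 1] by simp
  have "word_mean k (\<lambda>w. 1 - of_bool (nonzero S w)) \<le> word_mean k (\<lambda>w. of_bool (Q w))" for k
    using assms(2) by (intro word_mean_mono) auto
  then show "\<forall>\<^sub>F k in sequentially. 1 - word_mean k (\<lambda>w. of_bool (nonzero S w)) \<le> word_mean k (\<lambda>w. of_bool (Q w))"
    by (simp add: word_mean_diff)
  show "\<forall>\<^sub>F k in sequentially. word_mean k (\<lambda>w. of_bool (Q w)) \<le> 1"
    by (intro always_eventually allI word_mean_le_const) simp
qed auto

text \<open>Failure of either event keeps X nonempty throughout the word, so both limits are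
  1.\<close>

lemma win_hit_limits_eq:
  assumes "(\<lambda>k. word_mean k (\<lambda>w. of_bool (win n S w))) \<longlonglongrightarrow> P"
    "(\<lambda>k. word_mean k (\<lambda>w. of_bool (hit n S w))) \<longlonglongrightarrow> P'"
    and S: "queue_state S" "n \<le> S d" "0 < n"
  shows "P = P'"
proof -
  have "(\<lambda>k. word_mean k (\<lambda>w. of_bool (win n S w))) \<longlonglongrightarrow> 1"
    using S not_win_imp_nonzero by (intro limit_eq_1_of_not_imp_nonzero) auto
  moreover have "(\<lambda>k. word_mean k (\<lambda>w. of_bool (hit n S w))) \<longlonglongrightarrow> 1"
    using not_hit_imp_nonzero[of S n S] S by (intro limit_eq_1_of_not_imp_nonzero[OF S(1)]) auto
  ultimately show ?thesis using assms(1,2) LIMSEQ_unique by metis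
qed

end

section \<open>From words to the random walks\<close>

text \<open>Lets events about finitely many increments be written as countable unions, hence as
  measurable sets.\<close>

lemma countable_vectors: "countable (vectors d :: (nat \<Rightarrow> int) set)"
proof (rule countable_subset)
  show "vectors d \<subseteq> range (\<lambda>l::int list. \<lambda>j. if j \<in> {1..d} then l ! j else 0)"
  proof
    fix x :: "nat \<Rightarrow> int" assume "x \<in> vectors d"
    then have "x = (\<lambda>j. if j \<in> {1..d} then map x [0..<Suc d] ! j else 0)"
      by (auto simp: vectors_def fun_eq_iff nth_append simp del: upt_Suc)
    then show "x \<in> range (\<lambda>l::int list. \<lambda>j. if j \<in> {1..d} then l ! j else 0)" by blast
  qed
qed simp

lemma hitting_time_less_iff:
  "hitting_time A Z < hitting_time B Z \<longleftrightarrow> (\<exists>k. Z k \<in> A \<and> (\<forall>j\<le>k. Z j \<notin> B))"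
proof -
  have "enat k < hitting_time B Z \<longleftrightarrow> (\<forall>j\<le>k. Z j \<notin> B)" for k
  proof
    assume less: "enat k < hitting_time B Z"
    show "\<forall>j\<le>k. Z j \<notin> B"
    proof (intro allI impI notI)
      fix j assume "j \<le> k" "Z j \<in> B"
      then have "hitting_time B Z \<le> enat j" unfolding hitting_time_def by (intro Inf_lower) auto
      then show False using less \<open>j \<le> k\<close> by (metis enat_ord_simps(1) leD order_trans)
    qed
  next
    assume "\<forall>j\<le>k. Z j \<notin> B"
    then have "enat (Suc k) \<le> hitting_time B Z"
      unfolding hitting_time_def by (intro Inf_greatest) (force simp: not_less_eq_eq)
    then show "enat k < hitting_time B Z"
      by (metis enat_ord_simps(2) lessI less_le_trans)
  qed
  then show ?thesis
    unfolding hitting_time_def[of A] by (auto simp: Inf_less_iff)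
qed

lemma hitting_time_finite_iff: "hitting_time A Z < \<infinity> \<longleftrightarrow> (\<exists>k. Z k \<in> A)"
  unfolding hitting_time_def Inf_less_iff by auto

lemma constrained_walk_Suc:
  "constrained_walk S x v (Suc k) =
    constrained_walk S x v k + constrain S (constrained_walk S x v k) (v (Suc k))"
  by (rule ext) simp

lemma constrained_walk_cong:
  assumes "\<And>j. 1 \<le> j \<Longrightarrow> j \<le> k \<Longrightarrow> v j = v' j"
  shows "constrained_walk S x v k = constrained_walk S x v' k"
  using assms by (induction k) auto

lemma ex_bounded_cong:
  assumes "\<And>k. k \<le> (T::nat) \<Longrightarrow> f k = g k"
  shows "(\<exists>k\<le>T. f k = n \<and> (\<forall>j\<le>k. f j \<noteq> m)) \<longleftrightarrow> (\<exists>k\<le>T. g k = n \<and> (\<forall>j\<le>k. g j \<noteq> m))"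
proof (rule ex_cong1, rule conj_cong[OF refl])
  fix k assume k: "k \<le> T"
  have "f j = g j" if "j \<le> k" for j using assms[of j] that k by simp
  then show "(f k = n \<and> (\<forall>j\<le>k. f j \<noteq> m)) \<longleftrightarrow> (g k = n \<and> (\<forall>j\<le>k. g j \<noteq> m))" by auto
qed

section \<open>From coordinates to partial sums\<close>

definition psum :: "(nat \<Rightarrow> int) \<Rightarrow> nat \<Rightarrow> int" where
  "psum x i = (\<Sum>j=1..i. x j)"

lemma psum_plus: "psum (x + y) i = psum x i + psum y i"
  by (simp add: psum_def sum.distrib)

lemma psum_pred: "1 \<le> i \<Longrightarrow> psum x i = psum x (i - 1) + x i"
  by (cases i) (auto simp: psum_def)

text \<open>Seen through T_n, the reflected increments of Y are again those of X.\<close>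

lemma T_map_plus_reflect: "T_map n (y + reflect u) = T_map n y + u"
  by (auto simp: T_map_def reflect_def diag_I1_def fun_eq_iff)

lemma T_map_involution: "T_map n (T_map n x) = x"
  by (auto simp: T_map_def reflect_def diag_I1_def unit_vec_def fun_eq_iff)

context tandem
begin

definition increment :: "nat \<Rightarrow> nat \<Rightarrow> int" where
  "increment v = (if v = 0 then unit_vec 1
     else if v = d then - unit_vec d else - unit_vec v + unit_vec (v + 1))"

text \<open>The entry -1 marks the served node, so a letter can be read off its increment; distinct
  words then give disjoint events.\<close>

lemma increment_eq_minus_1_iff: "v \<le> d \<Longrightarrow> increment v j = -1 \<longleftrightarrow> j = v \<and> v \<noteq> 0"
  by (auto simp: increment_def unit_vec_def)

lemma inj_on_increment: "inj_on increment {..d}"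
proof (rule inj_onI)
  fix u v assume *: "u \<in> {..d}" "v \<in> {..d}" "increment u = increment v"
  then have "(j = u \<and> u \<noteq> 0) = (j = v \<and> v \<noteq> 0)" for j
    using increment_eq_minus_1_iff[of u j] increment_eq_minus_1_iff[of v j] by simp
  then show "u = v" by metis
qed

lemma increment_vectors: "v \<le> d \<Longrightarrow> increment v \<in> vectors d"
  using d_pos by (auto simp: increment_def unit_vec_def vectors_def)

text \<open>For a move from v to v + 1 the entries -1 and +1 cancel in every partial sum beyond
  v.\<close>

lemma psum_increment:
  assumes "v \<le> d" "i \<le> d"
  shows "psum (increment v) i = (if v = 0 then of_bool (0 < i) else - of_bool (i = v))"
proof -
  have unit: "psum (unit_vec u) i = of_bool (1 \<le> u \<and> u \<le> i)" for u
  proof -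
    have "psum (unit_vec u) i = (\<Sum>j\<in>{1..i}. if j = u then 1 else 0)"
      unfolding psum_def unit_vec_def by (intro sum.cong) auto
    also have "\<dots> = of_bool (1 \<le> u \<and> u \<le> i)" by (subst sum.delta) auto
    finally show ?thesis .
  qed
  have neg: "psum (- x) i = - psum x i" for x by (simp add: psum_def sum_negf)
  have "psum (- unit_vec v + unit_vec (v + 1)) i = - of_bool (1 \<le> v \<and> v \<le> i) + of_bool (v + 1 \<le> i)"
    by (simp only: psum_plus unit neg) simp
  then show ?thesis
    using assms unfolding increment_def by (auto simp only: unit neg split: if_splits) auto
qed

definition region :: "bool \<Rightarrow> (nat \<Rightarrow> int) set" where
  "region b = (if b then orthant d else Omega_Y d)"

lemma region_iff: "z \<in> region b \<longleftrightarrow> z \<in> vectors d \<and> (\<forall>j\<in>{1..d}. (j = 1 \<and> \<not> b) \<or> 0 \<le> z j)"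
proof -
  have "{1..d} = insert 1 {2..d}" using d_pos by auto
  then show ?thesis by (auto simp: region_def orthant_def Omega_Y_def)
qed

lemma plus_increment_region_iff:
  assumes "z \<in> region b" "v \<le> d"
  shows "z + increment v \<in> region b \<longleftrightarrow> v = 0 \<or> v = 1 \<and> \<not> b \<or> 1 \<le> z v"
proof -
  have vec: "z + increment v \<in> vectors d"
    using assms increment_vectors[OF assms(2)] by (auto simp: region_iff vectors_def)
  have ge: "j \<noteq> v \<or> v = 0 \<Longrightarrow> 0 \<le> increment v j" for j
    by (auto simp: increment_def unit_vec_def)
  have at: "v \<noteq> 0 \<Longrightarrow> increment v v = -1"
    using increment_eq_minus_1_iff[OF assms(2)] by simp
  show ?thesis
  proof
    assume "z + increment v \<in> region b"
    then have "(v = 1 \<and> \<not> b) \<or> 0 \<le> (z + increment v) v" if "v \<in> {1..d}"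
      using that unfolding region_iff by blast
    moreover have "v = 0 \<or> v \<in> {1..d}" using assms(2) by auto
    ultimately show "v = 0 \<or> v = 1 \<and> \<not> b \<or> 1 \<le> z v" using at by auto
  next
    assume v: "v = 0 \<or> v = 1 \<and> \<not> b \<or> 1 \<le> z v"
    have "(j = 1 \<and> \<not> b) \<or> 0 \<le> (z + increment v) j" if j: "j \<in> {1..d}" for j
    proof (cases "j = v \<and> v \<noteq> 0")
      case True
      then show ?thesis using v at by auto
    next
      case False
      then have "0 \<le> increment v j" using ge by blast
      moreover have "j = 1 \<and> \<not> b \<or> 0 \<le> z j" using assms(1) j unfolding region_iff by blast
      ultimately show ?thesis by auto
    qed
    then show "z + increment v \<in> region b" using vec unfolding region_iff by blast
  qed
qed

text \<open>At a nonempty node S (v - 1) \<le> S v - 1, so the maximum is not felt; at an empty node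
  S (v - 1) = S v, and the maximum undoes the service, which is the effect of \<pi>. Beyond index d
  the two sides part, because a departure from node d lowers all later partial sums.\<close>

lemma step_psum:
  assumes z: "z \<in> region b" and v: "v \<le> d" and S: "\<And>i. i \<le> d \<Longrightarrow> S i = psum z i" and i: "i \<le> d"
  shows "step b S v i = psum (z + constrain (region b) z (increment v)) i"
proof (cases "z + increment v \<in> region b")
  case True
  then have eq: "psum (z + constrain (region b) z (increment v)) i =
      psum z i + (if v = 0 then of_bool (0 < i) else - of_bool (i = v))"
    using psum_increment[OF v i] by (simp add: constrain_def psum_plus)
  show ?thesis
  proof (cases "v = 0 \<or> i \<noteq> v \<or> v = 1 \<and> \<not> b")
    case True
    then show ?thesis using S[OF i] unfolding eq step_def by auto
  next
    case False
    then have "1 \<le> z v" using plus_increment_region_iff[OF z v] True by blast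
    then have "S (v - 1) \<le> S v - 1"
      using S[OF v] S[of "v - 1"] v psum_pred[of v z] False by auto
    then show ?thesis using False S[OF i] unfolding eq step_def by auto
  qed
next
  case False
  then have "v \<noteq> 0" "v = 1 \<longrightarrow> b" "z v < 1"
    using plus_increment_region_iff[OF z v] by auto
  moreover have "0 \<le> z v"
    using z v calculation unfolding region_iff by (auto dest!: bspec[of _ _ v])
  ultimately have "z v = 0" "v \<noteq> 0" "v = 1 \<longrightarrow> b" by auto
  then have "S (v - 1) = S v"
    using S[OF v] S[of "v - 1"] v psum_pred[of v z] by auto
  then show ?thesis
    using False S[OF i] \<open>v \<noteq> 0\<close> \<open>v = 1 \<longrightarrow> b\<close> by (auto simp: step_def constrain_def)
qed

lemma constrain_region: "z \<in> region b \<Longrightarrow> z + constrain (region b) z u \<in> region b"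
  by (simp add: constrain_def)

text \<open>The walk reads its increments from index 1 on and lists are indexed from 0, hence
  \<open>k - 1\<close>.\<close>

lemma walk_psum:
  assumes x: "x \<in> region b" and w: "set w \<subseteq> {..d}" and k: "k \<le> length w"
  defines "Z \<equiv> constrained_walk (region b) x (\<lambda>k. map increment w ! (k - 1))"
  shows "Z k \<in> region b \<and> (\<forall>i\<le>d. foldl (step b) (psum x) (take k w) i = psum (Z k) i)"
  using k
proof (induction k)
  case 0
  then show ?case using x by (simp add: Z_def)
next
  case (Suc k)
  have "k \<le> length w" using Suc.prems by simp
  then have IH: "Z k \<in> region b" "\<And>i. i \<le> d \<Longrightarrow> foldl (step b) (psum x) (take k w) i = psum (Z k) i"
    using Suc.IH by blast+
  have "w ! k \<in> set w" using Suc.prems by (intro nth_mem) simp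
  then have v: "w ! k \<le> d" using w by auto
  have Z: "Z (Suc k) = Z k + constrain (region b) (Z k) (increment (w ! k))"
    using Suc.prems by (simp add: Z_def)
  show ?case
  proof (intro conjI allI impI)
    show "Z (Suc k) \<in> region b" unfolding Z by (rule constrain_region[OF IH(1)])
    fix i assume i: "i \<le> d"
    have "take (Suc k) w = take k w @ [w ! k]"
      using Suc.prems by (simp add: take_Suc_conv_app_nth)
    then have "foldl (step b) (psum x) (take (Suc k) w) i =
        step b (foldl (step b) (psum x) (take k w)) (w ! k) i" by simp
    also have "\<dots> = psum (Z (Suc k)) i"
      unfolding Z by (rule step_psum[OF IH(1) v IH(2) i])
    finally show "foldl (step b) (psum x) (take (Suc k) w) i = psum (Z (Suc k)) i" .
  qed
qed

lemma queue_state_psum: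
  assumes "x \<in> orthant d"
  shows "queue_state (psum x)"
  unfolding queue_state_def
proof (intro conjI ballI)
  fix i assume i: "i \<in> {1..d}"
  then have "0 \<le> x i" using assms by (auto simp: orthant_def)
  then show "psum x (i - 1) \<le> psum x i" using psum_pred[of i x] i by simp
qed (simp add: psum_def)

text \<open>\<open>win\<close> accepts as soon as the total is n, whereas the right-hand side also
  demands a nonzero total at that time; \<open>n \<noteq> 0\<close> reconciles the two.\<close>

lemma win_iff:
  assumes "n \<noteq> 0"
  shows "win n S w \<longleftrightarrow> (\<exists>k\<le>length w. foldl (step True) S (take k w) d = n \<and>
    (\<forall>j\<le>k. foldl (step True) S (take j w) d \<noteq> 0))"
proof (induction w arbitrary: S)
  case Nil
  then show ?case using assms by auto
next
  case (Cons v w)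
  have ex: "(\<exists>k\<le>Suc m. P k) \<longleftrightarrow> P 0 \<or> (\<exists>k\<le>m. P (Suc k))" for m P
    by (metis Suc_le_mono le0 old.nat.exhaust)
  have all: "(\<forall>j\<le>Suc m. P j) \<longleftrightarrow> P 0 \<and> (\<forall>j\<le>m. P (Suc j))" for m P
    by (metis Suc_le_mono le0 old.nat.exhaust)
  show ?case
    unfolding win.simps Cons.IH list.size add_Suc_right add_0_right ex all using assms by auto
qed

lemma hit_iff: "hit n R w \<longleftrightarrow> (\<exists>k\<le>length w. foldl (step False) R (take k w) d = n)"
proof (induction w arbitrary: R)
  case (Cons v w)
  have ex: "(\<exists>k\<le>Suc m. P k) \<longleftrightarrow> P 0 \<or> (\<exists>k\<le>m. P (Suc k))" for m P
    by (metis Suc_le_mono le0 old.nat.exhaust)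
  show ?case unfolding hit.simps Cons.IH list.size add_Suc_right add_0_right ex by auto
qed auto

lemma word_mean_eq_sum:
  "word_mean k f = (\<Sum>w | set w \<subseteq> {..d} \<and> length w = k. prod_list (map p w) * f w)"
proof (induction k arbitrary: f)
  case 0
  have "{w. set w \<subseteq> {..d} \<and> length w = 0} = {[]}" by auto
  then show ?case by simp
next
  case (Suc k)
  let ?W = "{w. set w \<subseteq> {..d} \<and> length w = k}"
  have "(\<Sum>w | set w \<subseteq> {..d} \<and> length w = Suc k. prod_list (map p w) * f w) =
      (\<Sum>(w, v)\<in>?W \<times> {..d}. prod_list (map p (v # w)) * f (v # w))"
    unfolding lists_length_Suc_eq
    by (subst sum.reindex) (auto simp: inj_on_def case_prod_beta)
  also have "\<dots> = (\<Sum>w\<in>?W. \<Sum>v\<le>d. p v * (prod_list (map p w) * f (v # w)))"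
    by (simp add: sum.cartesian_product mult.assoc)
  also have "\<dots> = (\<Sum>v\<le>d. \<Sum>w\<in>?W. p v * (prod_list (map p w) * f (v # w)))"
    by (rule sum.swap)
  also have "\<dots> = word_mean (Suc k) f"
    by (simp add: Suc sum_distrib_left)
  finally show ?case by simp
qed

end

section \<open>The probability space of the increments\<close>

locale tandem_process = tandem d p + prob_space M
  for d :: nat and p :: "nat \<Rightarrow> real" and M :: "'w measure" +
  fixes I :: "nat \<Rightarrow> 'w \<Rightarrow> nat \<Rightarrow> int"
  assumes indep: "indep_vars (\<lambda>_. count_space (vectors d)) I {1..}"
    and law: "\<And>k v. k \<ge> 1 \<Longrightarrow> v \<le> d \<Longrightarrow> prob {\<omega> \<in> space M. I k \<omega> = increment v} = p v"
begin

definition word :: "nat \<Rightarrow> 'w \<Rightarrow> (nat \<Rightarrow> int) list" where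
  "word T \<omega> = map (\<lambda>k. I k \<omega>) [1..<Suc T]"

lemma length_word [simp]: "length (word T \<omega>) = T"
  by (simp add: word_def)

lemma word_nth: "1 \<le> k \<Longrightarrow> k \<le> T \<Longrightarrow> word T \<omega> ! (k - 1) = I k \<omega>"
  by (cases k) (simp_all add: word_def del: upt_Suc)

lemma word_Suc: "word (Suc T) \<omega> = word T \<omega> @ [I (Suc T) \<omega>]"
  by (simp add: word_def)

lemma I_measurable: "1 \<le> k \<Longrightarrow> I k \<in> M \<rightarrow>\<^sub>M count_space (vectors d)"
  using indep by (auto simp: indep_vars_def)

text \<open>Q may be arbitrary because a word of increments takes only countably many values; the
  induction splits along the last one.\<close>

lemma word_event_measurable: "{\<omega> \<in> space M. Q (word T \<omega>)} \<in> sets M"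
proof (induction T arbitrary: Q)
  case 0
  then show ?case by (cases "Q []") (simp_all add: word_def)
next
  case (Suc T)
  have I: "I (Suc T) \<in> M \<rightarrow>\<^sub>M count_space (vectors d)" by (rule I_measurable) simp
  have "{\<omega> \<in> space M. Q (word (Suc T) \<omega>)} =
    (\<Union>v\<in>vectors d. (I (Suc T) -` {v} \<inter> space M) \<inter> {\<omega> \<in> space M. Q (word T \<omega> @ [v])})"
    using measurable_space[OF I] by (auto simp: word_Suc)
  also have "\<dots> \<in> sets M"
    using Suc[of "\<lambda>w. Q (w @ [_])"] measurable_sets[OF I]
    by (intro sets.countable_UN'[OF countable_vectors] sets.Int) auto
  finally show ?case .
qed

lemma prob_word_eq:
  assumes "set w \<subseteq> {..d}" "length w = T"
  shows "prob {\<omega> \<in> space M. word T \<omega> = map increment w} = prod_list (map p w)"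
proof (cases "T = 0")
  case True
  then show ?thesis using assms prob_space by (simp add: word_def)
next
  case False
  have inc: "increment (w ! (k - 1)) \<in> vectors d" "w ! (k - 1) \<le> d" if "k \<in> {1..T}" for k
  proof -
    have "w ! (k - 1) \<in> set w" using that assms(2) by (intro nth_mem) auto
    then show "w ! (k - 1) \<le> d" using assms(1) by auto
    then show "increment (w ! (k - 1)) \<in> vectors d" by (rule increment_vectors)
  qed
  have "{\<omega> \<in> space M. word T \<omega> = map increment w} =
      (\<Inter>k\<in>{1..T}. I k -` {increment (w ! (k - 1))} \<inter> space M)"
  proof -
    have "word T \<omega> = map increment w \<longleftrightarrow> (\<forall>k\<in>{1..T}. I k \<omega> = increment (w ! (k - 1)))" for \<omega>
    proof -
      have "word T \<omega> = map increment w \<longleftrightarrow> (\<forall>k<T. I (Suc k) \<omega> = increment (w ! k))"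
        using assms(2) by (auto simp: list_eq_iff_nth_eq word_def simp del: upt_Suc)
      also have "\<dots> \<longleftrightarrow> (\<forall>k\<in>{1..T}. I k \<omega> = increment (w ! (k - 1)))"
        by (auto simp: Ball_def) (metis Suc_le_eq Suc_pred diff_Suc_1 not_less_eq_eq zero_less_Suc)
      finally show ?thesis .
    qed
    then show ?thesis using False by auto
  qed
  also have "prob \<dots> = (\<Prod>k\<in>{1..T}. prob (I k -` {increment (w ! (k - 1))} \<inter> space M))"
    using False inc by (intro indep_varsD[OF indep]) auto
  also have "\<dots> = (\<Prod>k\<in>{1..T}. p (w ! (k - 1)))"
  proof (intro prod.cong refl)
    fix k assume k: "k \<in> {1..T}"
    have "I k -` {increment (w ! (k - 1))} \<inter> space M = {\<omega> \<in> space M. I k \<omega> = increment (w ! (k - 1))}"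
      by auto
    then show "prob (I k -` {increment (w ! (k - 1))} \<inter> space M) = p (w ! (k - 1))"
      using law[of k "w ! (k - 1)"] k inc[OF k] by simp
  qed
  also have "\<dots> = (\<Prod>k\<in>{..<T}. p (w ! k))"
    by (rule prod.reindex_bij_witness[of _ Suc "\<lambda>k. k - 1"]) auto
  also have "\<dots> = prod_list (map p w)"
    using assms(2) by (simp add: prod.list_conv_set_nth atLeast0LessThan)
  finally show ?thesis .
qed

lemma word_mean_le_prob:
  "word_mean T (\<lambda>w. of_bool (Q (map increment w))) \<le> prob {\<omega> \<in> space M. Q (word T \<omega>)}"
proof -
  let ?W = "{w. (set w \<subseteq> {..d} \<and> length w = T) \<and> Q (map increment w)}"
  let ?E = "\<lambda>w. {\<omega> \<in> space M. word T \<omega> = map increment w}"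
  have fin: "finite {w. set w \<subseteq> {..d} \<and> length w = T}" by (intro finite_lists_length_eq) simp
  have "word_mean T (\<lambda>w. of_bool (Q (map increment w))) =
      (\<Sum>w\<in>?W. prod_list (map p w))"
    unfolding word_mean_eq_sum using fin
    by (intro sum.mono_neutral_cong_right) auto
  also have "\<dots> = (\<Sum>w\<in>?W. prob (?E w))"
    using prob_word_eq by (intro sum.cong) auto
  also have "\<dots> = prob (\<Union>w\<in>?W. ?E w)"
  proof (rule finite_measure_finite_Union[symmetric])
    show "finite ?W" using fin by (rule rev_finite_subset) auto
    show "?E ` ?W \<subseteq> sets M"
      using word_event_measurable[of "\<lambda>l. l = map increment _"] by (rule image_subsetI)
    show "disjoint_family_on ?E ?W"
      unfolding disjoint_family_on_def
    proof (intro ballI impI)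
      fix u w assume uw: "u \<in> ?W" "w \<in> ?W" "u \<noteq> w"
      then have "map increment u \<noteq> map increment w"
        using map_inj_on[of increment u w] inj_on_subset[OF inj_on_increment, of "set u \<union> set w"] by auto
      then show "?E u \<inter> ?E w = {}" by auto
    qed
  qed
  also have "\<dots> \<le> prob {\<omega> \<in> space M. Q (word T \<omega>)}"
    by (intro finite_measure_mono word_event_measurable) auto
  finally show ?thesis .
qed

text \<open>Increments outside the listed ones are null, but this is obtained only implicitly: the
  inequality \<open>word_mean_le_prob\<close> for Q and for its negation forces equality, since both
  sides sum to 1.\<close>

lemma prob_eq_word_mean:
  "prob {\<omega> \<in> space M. Q (word T \<omega>)} = word_mean T (\<lambda>w. of_bool (Q (map increment w)))"
proof (rule antisym)
  have "prob {\<omega> \<in> space M. \<not> Q (word T \<omega>)} = 1 - prob {\<omega> \<in> space M. Q (word T \<omega>)}"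
    using prob_neg[of "\<lambda>\<omega>. Q (word T \<omega>)"] word_event_measurable by auto
  moreover have "word_mean T (\<lambda>w. of_bool (\<not> Q (map increment w))) =
      1 - word_mean T (\<lambda>w. of_bool (Q (map increment w)))"
    using word_mean_diff[of T "\<lambda>_. 1" "\<lambda>w. of_bool (Q (map increment w))"]
    by (simp add: of_bool_not_iff)
  ultimately show "prob {\<omega> \<in> space M. Q (word T \<omega>)} \<le> word_mean T (\<lambda>w. of_bool (Q (map increment w)))"
    using word_mean_le_prob[of T "\<lambda>w. \<not> Q w"] by simp
qed (rule word_mean_le_prob)

text \<open>Continuity from below: E is the increasing union of what is decided by time T.\<close>

lemma word_mean_tendsto_prob:
  assumes event: "\<And>\<omega>. E \<omega> \<longleftrightarrow> (\<exists>T. Q (word T \<omega>))"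
    and mono: "\<And>\<omega> T. Q (word T \<omega>) \<Longrightarrow> Q (word (Suc T) \<omega>)"
    and eq: "\<And>w. set w \<subseteq> {..d} \<Longrightarrow> Q (map increment w) \<longleftrightarrow> R w"
  shows "(\<lambda>T. word_mean T (\<lambda>w. of_bool (R w))) \<longlonglongrightarrow> prob {\<omega> \<in> space M. E \<omega>}"
proof -
  let ?A = "\<lambda>T. {\<omega> \<in> space M. Q (word T \<omega>)}"
  have "(\<lambda>T. prob (?A T)) \<longlonglongrightarrow> prob (\<Union>T. ?A T)"
    using word_event_measurable mono by (intro finite_Lim_measure_incseq) (auto intro: incseq_SucI)
  moreover have "(\<Union>T. ?A T) = {\<omega> \<in> space M. E \<omega>}" using event by auto
  moreover have "prob (?A T) = word_mean T (\<lambda>w. of_bool (R w))" for T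
    unfolding prob_eq_word_mean using eq by (intro word_mean_cong) auto
  ultimately show ?thesis by simp
qed

lemma word_walk:
  assumes "k \<le> T"
  shows "constrained_walk S x (\<lambda>k. word T \<omega> ! (k - 1)) k = constrained_walk S x (\<lambda>k. I k \<omega>) k"
  using assms word_nth by (intro constrained_walk_cong) auto

lemma win_tendsto_prob_X:
  assumes x: "x \<in> orthant d" and n: "0 < n"
  shows "(\<lambda>T. word_mean T (\<lambda>w. of_bool (win (int n) (psum x) w))) \<longlonglongrightarrow> prob_X d M I n x"
proof -
  \<comment> \<open>Stated for lists of increments rather than letters, so that it also makes sense
    on the null set where an increment belongs to no letter.\<close>
  define Q where "Q ws \<longleftrightarrow> (\<exists>k\<le>length ws.
      psum (constrained_walk (orthant d) x (\<lambda>k. ws ! (k - 1)) k) d = int n \<and>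
      (\<forall>j\<le>k. psum (constrained_walk (orthant d) x (\<lambda>k. ws ! (k - 1)) j) d \<noteq> 0))" for ws
  have Q_word: "Q (word T \<omega>) \<longleftrightarrow> (\<exists>k\<le>T. psum (walk_X d I x \<omega> k) d = int n \<and>
      (\<forall>j\<le>k. psum (walk_X d I x \<omega> j) d \<noteq> 0))" for T \<omega>
    unfolding Q_def walk_X_def length_word by (rule ex_bounded_cong) (simp only: word_walk)
  show ?thesis
    unfolding prob_X_def
  proof (rule word_mean_tendsto_prob[where Q = Q])
    fix \<omega>
    show "tau_X d I n x \<omega> < tau_X d I 0 x \<omega> \<longleftrightarrow> (\<exists>T. Q (word T \<omega>))"
      unfolding tau_X_def hitting_time_less_iff Q_word by (auto simp: psum_def)
    show "Q (word (Suc T) \<omega>)" if "Q (word T \<omega>)" for T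
      using that unfolding Q_word by (meson le_SucI)
  next
    fix w assume w: "set w \<subseteq> {..d}"
    have "x \<in> region True" using x by (simp add: region_def)
    from walk_psum[OF this w]
    have walk: "psum (constrained_walk (orthant d) x (\<lambda>k. map increment w ! (k - 1)) k) d =
        foldl (step True) (psum x) (take k w) d" if "k \<le> length w" for k
      using that by (simp add: region_def)
    have "int n \<noteq> 0" using n by simp
    show "Q (map increment w) \<longleftrightarrow> win (int n) (psum x) w"
      unfolding Q_def win_iff[OF \<open>int n \<noteq> 0\<close>] length_map
      by (rule ex_bounded_cong) (rule walk)
  qed
qed

text \<open>T_n is an involution preserving \<open>Omega_Y d\<close>, so a step of Y is blocked
  exactly when its image is. The image is the walk with the increments of X in which node 1 is
  unconstrained.\<close>

lemma T_map_constrained_walk: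
  "T_map n (constrained_walk (Omega_Y d) (T_map n x) (\<lambda>k. reflect (v k)) k) =
    constrained_walk (Omega_Y d) x v k"
proof (induction k)
  case 0
  then show ?case by (simp add: T_map_involution)
next
  case (Suc k)
  let ?Y = "constrained_walk (Omega_Y d) (T_map n x) (\<lambda>k. reflect (v k)) k"
  have mem: "T_map n y \<in> Omega_Y d \<longleftrightarrow> y \<in> Omega_Y d" for y
    using d_pos by (auto simp: T_map_def reflect_def diag_I1_def unit_vec_def Omega_Y_def vectors_def)
  have "constrain (Omega_Y d) ?Y (reflect u) = reflect (constrain (Omega_Y d) (T_map n ?Y) u)" for u
  proof -
    have "?Y + reflect u \<in> Omega_Y d \<longleftrightarrow> T_map n ?Y + u \<in> Omega_Y d"
      using mem[of "?Y + reflect u"] by (simp add: T_map_plus_reflect)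
    moreover have "reflect 0 = 0" by (simp add: reflect_def fun_eq_iff)
    ultimately show ?thesis by (simp add: constrain_def)
  qed
  then show ?case by (simp only: constrained_walk_Suc T_map_plus_reflect Suc)
qed

lemma hit_tendsto_prob_Y:
  assumes x: "x \<in> orthant d"
  shows "(\<lambda>T. word_mean T (\<lambda>w. of_bool (hit (int n) (psum x) w))) \<longlonglongrightarrow> prob_Y d M I (T_map n x)"
proof -
  have xO: "x \<in> Omega_Y d" using x by (auto simp: orthant_def Omega_Y_def)
  have in_region: "constrained_walk (Omega_Y d) x v k \<in> Omega_Y d" for v k
  proof (induction k)
    case (Suc k)
    then show ?case unfolding constrained_walk_Suc by (auto simp: constrain_def plus_fun_def)
  qed (simp add: xO)
  have boundary: "T_map n z \<in> boundary_B d \<longleftrightarrow> psum z d = int n" if "z \<in> Omega_Y d" for z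
  proof -
    have "T_map n z \<in> Omega_Y d"
      using that d_pos by (auto simp: T_map_def reflect_def diag_I1_def unit_vec_def Omega_Y_def vectors_def)
    moreover have "T_map n z 1 = int n - z 1"
      by (simp add: T_map_def reflect_def diag_I1_def unit_vec_def)
    moreover have "(\<Sum>j=2..d. T_map n z j) = (\<Sum>j=2..d. z j)"
      by (intro sum.cong) (auto simp: T_map_def reflect_def diag_I1_def unit_vec_def)
    moreover have "psum z d = z 1 + (\<Sum>j=2..d. z j)"
      unfolding psum_def using d_pos by (simp add: sum.atLeast_Suc_atMost numeral_2_eq_2)
    ultimately show ?thesis by (auto simp: boundary_B_def)
  qed
  define Q where "Q ws \<longleftrightarrow> (\<exists>k\<le>length ws.
      psum (constrained_walk (Omega_Y d) x (\<lambda>k. ws ! (k - 1)) k) d = int n)" for ws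
  have Q_word: "Q (word T \<omega>) \<longleftrightarrow> (\<exists>k\<le>T. walk_Y d I (T_map n x) \<omega> k \<in> boundary_B d)" for T \<omega>
  proof -
    have "walk_Y d I (T_map n x) \<omega> k \<in> boundary_B d \<longleftrightarrow>
        psum (constrained_walk (Omega_Y d) x (\<lambda>k. I k \<omega>) k) d = int n" for k
    proof -
      have "walk_Y d I (T_map n x) \<omega> k = T_map n (constrained_walk (Omega_Y d) x (\<lambda>k. I k \<omega>) k)"
        unfolding walk_Y_def by (metis T_map_constrained_walk T_map_involution)
      then show ?thesis using boundary[OF in_region] by simp
    qed
    then show ?thesis
      unfolding Q_def length_word by (intro ex_cong1 conj_cong refl) (simp only: word_walk)
  qed
  show ?thesis
    unfolding prob_Y_def
  proof (rule word_mean_tendsto_prob[where Q = Q])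
    fix \<omega>
    show "tau_Y d I (T_map n x) \<omega> < \<infinity> \<longleftrightarrow> (\<exists>T. Q (word T \<omega>))"
      unfolding tau_Y_def hitting_time_finite_iff Q_word by auto
    show "Q (word (Suc T) \<omega>)" if "Q (word T \<omega>)" for T
      using that unfolding Q_word by (meson le_SucI)
  next
    fix w assume w: "set w \<subseteq> {..d}"
    have "x \<in> region False" using xO by (simp add: region_def)
    from walk_psum[OF this w]
    have walk: "psum (constrained_walk (Omega_Y d) x (\<lambda>k. map increment w ! (k - 1)) k) d =
        foldl (step False) (psum x) (take k w) d" if "k \<le> length w" for k
      using that by (simp add: region_def)
    show "Q (map increment w) \<longleftrightarrow> hit (int n) (psum x) w"
      unfolding Q_def hit_iff length_map by (intro ex_cong1 conj_cong refl) (simp only: walk)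
  qed
qed

end

context tandem_process
begin

section \<open>The relative error\<close>

lemma rho_max_eq_load:
  assumes "\<And>i. i \<in> {1..d} \<Longrightarrow> mu i = p i"
  shows "rho_max d (p 0) mu = load"
proof -
  have "rho_i (p 0) mu ` {1..d} = (\<lambda>i. p 0 / p i) ` {1..d}"
    using assms by (intro image_cong) (auto simp: rho_i_def)
  then show ?thesis by (simp add: rho_max_def load_def)
qed

lemma log_load:
  assumes "i \<in> {1..d}"
  shows "1 \<le> log load (p 0 / p i)"
    and "ln load / ln (p 0 / p i) = 1 / log load (p 0 / p i)"
    and "load powr (log load (p 0 / p i) * y) = (p 0 / p i) powr y"
proof -
  have p: "0 < p 0 / p i" using p_pos[of 0] p_pos[of i] assms by simp
  have le: "p 0 / p i \<le> load" by (rule load_ge[OF assms])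
  have "ln load < 0" using load_pos load_less_1 by simp
  moreover have "ln (p 0 / p i) \<le> ln load" using p le load_pos by simp
  ultimately show "1 \<le> log load (p 0 / p i)" unfolding log_def by (simp add: neg_le_divide_eq)
  show "ln load / ln (p 0 / p i) = 1 / log load (p 0 / p i)" by (simp add: log_def)
  have "load powr log load (p 0 / p i) = p 0 / p i"
    using p load_pos load_less_1 by (intro powr_log_cancel) auto
  then show "load powr (log load (p 0 / p i) * y) = (p 0 / p i) powr y"
    by (metis powr_powr)
qed

lemma g_fun_le:
  assumes "\<And>i. i \<in> {1..d} \<Longrightarrow> mu i = p i" "i \<in> {1..d}"
  shows "g_fun d (p 0) mu x \<le> (1 - (\<Sum>j=1..i. x j)) * log load (p 0 / p i)"
proof -
  have "g_fun d (p 0) mu x \<le> (1 - (\<Sum>j=1..i. x j)) * log (rho_max d (p 0) mu) (rho_i (p 0) mu i)"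
    unfolding g_fun_def using assms(2) by (intro Min_le) auto
  then show ?thesis using assms rho_max_eq_load[OF assms(1)] by (simp add: rho_i_def)
qed

lemma g_fun_attained:
  assumes "\<And>i. i \<in> {1..d} \<Longrightarrow> mu i = p i"
  obtains i where "i \<in> {1..d}" "g_fun d (p 0) mu x = (1 - (\<Sum>j=1..i. x j)) * log load (p 0 / p i)"
proof -
  have "g_fun d (p 0) mu x \<in>
      (\<lambda>i. (1 - (\<Sum>j=1..i. x j)) * log (rho_max d (p 0) mu) (rho_i (p 0) mu i)) ` {1..d}"
    unfolding g_fun_def using d_pos by (intro Min_in) auto
  then obtain i where i: "i \<in> {1..d}"
    "g_fun d (p 0) mu x = (1 - (\<Sum>j=1..i. x j)) * log (rho_max d (p 0) mu) (rho_i (p 0) mu i)"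
    by blast
  show ?thesis
    using i rho_max_eq_load[OF assms] assms[OF i(1)] by (intro that[OF i(1)]) (simp add: rho_i_def)
qed

lemma R_bar_iff:
  assumes "\<And>i. i \<in> {1..d} \<Longrightarrow> mu i = p i"
  shows "x \<in> R_bar d (p 0) mu n \<longleftrightarrow> x \<in> orthant d \<and>
    (\<exists>i\<in>{1..d}. 1 + real n * (1 - 1 / log load (p 0 / p i)) \<le> psum x i)"
proof -
  have "ln (rho_max d (p 0) mu) / ln (rho_i (p 0) mu i) = 1 / log load (p 0 / p i)" if "i \<in> {1..d}" for i
    using log_load(2)[OF that] rho_max_eq_load[OF assms] assms[OF that] by (simp add: rho_i_def)
  then show ?thesis unfolding R_bar_def psum_def by auto
qed

lemma sum_scaled: "(\<Sum>j=1..i. scaled n x j) = psum x i / n"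
  by (simp add: scaled_def psum_def sum_divide_distrib)

lemma rel_error_le:
  assumes mu: "\<And>i. i \<in> {1..d} \<Longrightarrow> mu i = p i" and \<epsilon>: "0 < \<epsilon>"
  obtains n0 :: nat where "0 < n0" "\<And>n x. n > n0 \<Longrightarrow> x \<in> R_bar d (p 0) mu n \<Longrightarrow>
    rel_error d M I n x \<le> load powr (n * (1 - g_fun d (p 0) mu (scaled n x) - \<epsilon>))"
proof -
  \<comment> \<open>One e is the loss in the absolute error; the other swallows the constant C / (1
    - \<open>load\<close>) once n \<ge> N. The cap at 1 keeps e below 1, as
    \<open>win_hit_difference_le\<close> requires.\<close>
  define e where "e = min \<epsilon> 1 / 2"
  have e: "0 < e" "e < 1" "2 * e \<le> \<epsilon>" using \<epsilon> by (auto simp: e_def)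
  obtain C where C: "0 < C" "\<And>n S k. queue_state S \<Longrightarrow> S d \<le> int n \<Longrightarrow>
    \<bar>word_mean k (\<lambda>w. of_bool (win n S w)) - word_mean k (\<lambda>w. of_bool (hit n S w))\<bar>
      \<le> C * load powr (n * (1 - e))"
    using win_hit_difference_le[OF e(1,2)] by metis
  have l1: "0 < 1 - load" using load_less_1 by simp
  have le1: "load powr e < 1" using load_pos load_less_1 e by (simp add: powr01_less_one)
  obtain N where N: "(load powr e) ^ N < (1 - load) / C"
    using real_arch_pow_inv[of "(1 - load) / C" "load powr e"] l1 C(1) le1 by auto
  show ?thesis
  proof (rule that)
    show "0 < Suc N" by simp
    fix n :: nat and x assume n: "n > Suc N" and x: "x \<in> R_bar d (p 0) mu n"
    then have n0: "0 < n" by simp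
    define g where "g = g_fun d (p 0) mu (scaled n x)"
    obtain i0 where i0: "i0 \<in> {1..d}" "1 + real n * (1 - 1 / log load (p 0 / p i0)) \<le> psum x i0"
      and xo: "x \<in> orthant d" using x R_bar_iff[of mu x n] mu by blast
    have S: "queue_state (psum x)" by (rule queue_state_psum[OF xo])
    note limX = win_tendsto_prob_X[OF xo n0]
    note limY = hit_tendsto_prob_Y[OF xo, of n]
    let ?X = "prob_X d M I n x" and ?Y = "prob_Y d M I (T_map n x)"
    show "rel_error d M I n x \<le> load powr (n * (1 - g_fun d (p 0) mu (scaled n x) - \<epsilon>))"
    proof (cases "int n \<le> psum x d")
      case True
      then have "?X = ?Y" using win_hit_limits_eq[OF limX limY S] n0 by simp
      then show ?thesis by (simp add: rel_error_def)
    next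
      case False
      then have Sd: "psum x d \<le> int n" by simp
      have "(\<lambda>k. \<bar>word_mean k (\<lambda>w. of_bool (win n (psum x) w)) - word_mean k (\<lambda>w. of_bool (hit n (psum x) w))\<bar>)
          \<longlonglongrightarrow> \<bar>?X - ?Y\<bar>"
        by (intro tendsto_intros limX limY)
      then have diff: "\<bar>?X - ?Y\<bar> \<le> C * load powr (n * (1 - e))"
        by (rule LIMSEQ_le_const2) (use C(2)[OF S Sd] in blast)
      obtain i where i: "i \<in> {1..d}"
        and g: "g = (1 - psum x i / n) * log load (p 0 / p i)"
        using g_fun_attained[OF mu, of "scaled n x"] unfolding g_def sum_scaled by metis
      \<comment> \<open>The summand 1 in \<open>R_bar\<close> makes this strict: the bound is (1 / l
        - 1 / n) * l = 1 - l / n.\<close>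
      have "g < 1"
      proof -
        define l where "l = log load (p 0 / p i0)"
        have l: "1 \<le> l" unfolding l_def by (rule log_load(1)[OF i0(1)])
        have "(1 + real n * (1 - 1 / l)) / n \<le> psum x i0 / n"
          using i0(2) unfolding l_def by (rule divide_right_mono) simp
        moreover have "(1 + real n * (1 - 1 / l)) / n = 1 / n + (1 - 1 / l)"
          using n0 by (simp add: add_divide_distrib)
        ultimately have "1 - psum x i0 / n \<le> 1 / l - 1 / n" by linarith
        have "g \<le> (1 - psum x i0 / n) * l"
          using g_fun_le[OF mu i0(1), of "scaled n x"] unfolding g_def l_def sum_scaled .
        also have "\<dots> \<le> (1 / l - 1 / n) * l"
          using \<open>1 - psum x i0 / n \<le> 1 / l - 1 / n\<close> l by (intro mult_right_mono) auto
        also have "\<dots> < 1" using l n0 by (simp add: left_diff_distrib)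
        finally show ?thesis .
      qed
      \<comment> \<open>At the minimising i, an empty partial sum would make g equal to a logarithm
        that is at least 1.\<close>
      have "1 \<le> psum x i"
      proof (rule ccontr)
        assume "\<not> 1 \<le> psum x i"
        then have "psum x i = 0" using queue_state_nonneg[OF S, of i] i by auto
        then show False using g log_load(1)[OF i] \<open>g < 1\<close> by simp
      qed
      then have "(1 - load) * (p 0 / p i) powr (int n - psum x i) \<le> ?X"
        using win_limit_ge[OF limX S Sd i] by simp
      moreover have "(p 0 / p i) powr (int n - psum x i) = load powr (n * g)"
      proof -
        have "log load (p 0 / p i) * (int n - psum x i) = n * g"
          unfolding g using n0 by (simp add: field_simps)
        then show ?thesis by (metis log_load(3)[OF i])
      qed
      ultimately have X: "(1 - load) * load powr (n * g) \<le> ?X" by simp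
      have pos: "0 < (1 - load) * load powr (n * g)" using l1 load_pos by simp
      have "rel_error d M I n x \<le> C * load powr (n * (1 - e)) / ((1 - load) * load powr (n * g))"
        unfolding rel_error_def using diff X pos C(1) by (intro frac_le) auto
      also have "\<dots> = C / (1 - load) * load powr (n * (1 - e) - n * g)"
        by (simp add: powr_diff)
      also have "n * (1 - e) - n * g = n * (1 - g - 2 * e) + e * n" by (simp add: algebra_simps)
      also have "load powr (n * (1 - g - 2 * e) + e * n) = load powr (n * (1 - g - 2 * e)) * (load powr e) ^ n"
        using load_pos by (simp add: powr_add powr_powr[symmetric] powr_realpow)
      also have "C / (1 - load) * (load powr (n * (1 - g - 2 * e)) * (load powr e) ^ n) =
          (C / (1 - load) * (load powr e) ^ n) * load powr (n * (1 - g - 2 * e))" by simp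
      also have "\<dots> \<le> 1 * load powr (n * (1 - g - 2 * e))"
      proof (rule mult_right_mono)
        have "(load powr e) ^ n \<le> (load powr e) ^ N" using n le1 by (intro power_decreasing) auto
        also note N
        finally show "C / (1 - load) * (load powr e) ^ n \<le> 1" using C(1) l1 by (simp add: field_simps)
      qed simp
      also have "\<dots> \<le> load powr (n * (1 - g - \<epsilon>))"
        using e(3) load_pos load_less_1 by (auto intro!: powr_mono' mult_left_mono)
      finally show ?thesis by (simp add: g_def)
    qed
  qed
qed

lemma rel_error_nonneg: "0 \<le> rel_error d M I n x"
  by (simp add: rel_error_def prob_X_def)

lemma
  assumes mu: "\<And>i. i \<in> {1..d} \<Longrightarrow> mu i = p i"
    and x: "x \<in> A_set d - R_rho d (p 0) mu"
  shows g_fun_less_1: "g_fun d (p 0) mu x < 1"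
    and liminf_rel_error_ge:
      "\<lbrakk>\<And>n. n \<ge> 1 \<Longrightarrow> xs n \<in> orthant d; \<And>j. j \<in> {1..d} \<Longrightarrow> (\<lambda>n. scaled n (xs n) j) \<longlonglongrightarrow> x j\<rbrakk> \<Longrightarrow>
        ereal (- ln load * (1 - g_fun d (p 0) mu x))
          \<le> liminf (\<lambda>n. ereal (1 / real n) * neg_log (rel_error d M I n (xs n)))"
proof -
  have "x \<in> orthant d" using x by (simp add: A_set_def)
  then obtain i where i: "i \<in> {1..d}"
    "\<not> (\<Sum>j=1..i. x j) \<le> 1 - ln (rho_max d (p 0) mu) / ln (rho_i (p 0) mu i)"
    using x by (auto simp: R_rho_def)
  define l where "l = log load (p 0 / p i)"
  have l: "1 \<le> l" unfolding l_def by (rule log_load(1)[OF i(1)])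
  have si: "1 - 1 / l < (\<Sum>j=1..i. x j)"
    using i(2) log_load(2)[OF i(1)] rho_max_eq_load[OF mu] mu[OF i(1)] by (simp add: rho_i_def l_def)
  have "g_fun d (p 0) mu x \<le> (1 - (\<Sum>j=1..i. x j)) * l"
    unfolding l_def by (rule g_fun_le[OF mu i(1)])
  also have "\<dots> < 1 / l * l" using si l by (intro mult_strict_right_mono) auto
  finally show g1: "g_fun d (p 0) mu x < 1" using l by simp
  assume xs: "\<And>n. n \<ge> 1 \<Longrightarrow> xs n \<in> orthant d"
    and lim: "\<And>j. j \<in> {1..d} \<Longrightarrow> (\<lambda>n. scaled n (xs n) j) \<longlonglongrightarrow> x j"
  have lim_sum: "(\<lambda>n. psum (xs n) k / n) \<longlonglongrightarrow> (\<Sum>j=1..k. x j)" if "k \<in> {1..d}" for k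
    unfolding sum_scaled[symmetric] using that by (intro tendsto_sum lim) auto
  define L where "L = - ln load"
  have L: "0 < L" using load_pos load_less_1 by (simp add: L_def)
  define g where "g = g_fun d (p 0) mu x"
  show "ereal (- ln load * (1 - g_fun d (p 0) mu x))
          \<le> liminf (\<lambda>n. ereal (1 / real n) * neg_log (rel_error d M I n (xs n)))"
    unfolding L_def[symmetric] g_def[symmetric] le_Liminf_iff
  proof (intro allI impI)
    fix y assume "y < ereal (L * (1 - g))"
    then obtain r where r: "y < ereal r" "r < L * (1 - g)"
      using ereal_dense2[of y "ereal (L * (1 - g))"] by auto
    \<comment> \<open>The slack between r and the claimed rate is 2 * L * \<epsilon>: one \<epsilon>
      goes into \<open>rel_error_le\<close>, the other into replacing g at the scaled points by its
      value at x.\<close>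
    define \<epsilon> where "\<epsilon> = (L * (1 - g) - r) / (2 * L)"
    have \<epsilon>: "0 < \<epsilon>" using r L by (simp add: \<epsilon>_def)
    have r_eq: "r = L * (1 - g - 2 * \<epsilon>)" using L by (simp add: \<epsilon>_def field_simps)
    obtain n0 where n0: "\<And>n x. n > n0 \<Longrightarrow> x \<in> R_bar d (p 0) mu n \<Longrightarrow>
      rel_error d M I n x \<le> load powr (n * (1 - g_fun d (p 0) mu (scaled n x) - \<epsilon>))"
      using rel_error_le[OF mu \<epsilon>] by metis
    have "(\<lambda>n. psum (xs n) i / n - 1 / real n) \<longlonglongrightarrow> (\<Sum>j=1..i. x j) - 0"
      using i(1) by (intro tendsto_diff lim_sum lim_1_over_n)
    \<comment> \<open>Since x violates an inequality of \<open>R_rho\<close> strictly, there is room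
      for the 1 / n that the summand 1 in \<open>R_bar\<close> contributes.\<close>
    then have ev1: "\<forall>\<^sub>F n in sequentially. 1 - 1 / l < psum (xs n) i / n - 1 / real n"
      using si by (intro order_tendstoD(1)) auto
    \<comment> \<open>An upper bound on g near x suffices, so it is enough to follow the one term of
      the minimum that is attained at x.\<close>
    obtain k where k: "k \<in> {1..d}" "g = (1 - (\<Sum>j=1..k. x j)) * log load (p 0 / p k)"
      using g_fun_attained[OF mu, of x] unfolding g_def by metis
    have "(\<lambda>n. (1 - psum (xs n) k / n) * log load (p 0 / p k)) \<longlonglongrightarrow> g"
      unfolding k(2) by (intro tendsto_intros lim_sum k(1))
    then have ev2: "\<forall>\<^sub>F n in sequentially. (1 - psum (xs n) k / n) * log load (p 0 / p k) < g + \<epsilon>"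
      using \<epsilon> by (intro order_tendstoD(2)) auto
    show "\<forall>\<^sub>F n in sequentially. y < ereal (1 / real n) * neg_log (rel_error d M I n (xs n))"
      using ev1 ev2 eventually_gt_at_top[of n0] eventually_gt_at_top[of 0]
    proof eventually_elim
      case (elim n)
      let ?e = "rel_error d M I n (xs n)"
      have "1 + real n * (1 - 1 / l) \<le> psum (xs n) i" using elim(1,4) by (simp add: field_simps)
      then have "xs n \<in> R_bar d (p 0) mu n"
        using R_bar_iff[of mu "xs n" n] mu xs[of n] elim(4) i(1) unfolding l_def by force
      with elim(3) have e_le: "?e \<le> load powr (n * (1 - g_fun d (p 0) mu (scaled n (xs n)) - \<epsilon>))"
        by (rule n0)
      have "g_fun d (p 0) mu (scaled n (xs n)) < g + \<epsilon>"
        using g_fun_le[OF mu k(1), of "scaled n (xs n)"] elim(2) unfolding sum_scaled by simp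
      show "y < ereal (1 / real n) * neg_log ?e"
      proof (cases "?e = 0")
        case True
        then show ?thesis using elim(4) r(1) by (cases y) (auto simp: neg_log_def)
      next
        case False
        then have "0 < ?e" using rel_error_nonneg[of n "xs n"] by simp
        then have "ln ?e \<le> ln (load powr (n * (1 - g_fun d (p 0) mu (scaled n (xs n)) - \<epsilon>)))"
          using e_le load_pos by (subst ln_le_cancel_iff) auto
        also have "\<dots> = - (n * (L * (1 - g_fun d (p 0) mu (scaled n (xs n)) - \<epsilon>)))"
          using load_pos by (simp add: ln_powr L_def)
        finally have "n * (L * (1 - g_fun d (p 0) mu (scaled n (xs n)) - \<epsilon>)) \<le> - ln ?e" by simp
        moreover have "n * r \<le> n * (L * (1 - g_fun d (p 0) mu (scaled n (xs n)) - \<epsilon>))"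
          unfolding r_eq using \<open>g_fun d (p 0) mu (scaled n (xs n)) < g + \<epsilon>\<close> L
          by (intro mult_left_mono) auto
        ultimately have "r \<le> 1 / n * (- ln ?e)" using elim(4) by (simp add: field_simps)
        then show ?thesis using r(1) False by (simp add: neg_log_def less_le_trans)
      qed
    qed
  qed
qed

end

theorem theorem1p1:
  fixes d :: nat and lam :: real and mu :: "nat \<Rightarrow> real"
    and M :: "'w measure" and I :: "nat \<Rightarrow> 'w \<Rightarrow> nat \<Rightarrow> int"
  assumes "d \<ge> 3"
    and "lam > 0" and "\<forall>i\<in>{1..d}. mu i > 0"
    and "lam + (\<Sum>i=1..d. mu i) = 1"
    and "\<forall>i\<in>{1..d}. lam < mu i"
    and "prob_space M" and "iid_increments d lam mu M I"
  shows "(\<forall>\<epsilon>>0. \<exists>n0::nat. n0 > 0 \<and>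
            (\<forall>n>n0. \<forall>x\<in>R_bar d lam mu n.
               rel_error d M I n x
                 \<le> rho_max d lam mu powr (real n * (1 - g_fun d lam mu (scaled n x) - \<epsilon>))))
       \<and> (\<forall>xs :: nat \<Rightarrow> nat \<Rightarrow> int. \<forall>x \<in> A_set d - R_rho d lam mu.
            (\<forall>n\<ge>1. xs n \<in> orthant d) \<and>
            (\<forall>j\<in>{1..d}. (\<lambda>n. scaled n (xs n) j) \<longlonglongrightarrow> x j) \<longrightarrow>
              - ln (rho_max d lam mu) * (1 - g_fun d lam mu x) > 0 \<and>
              liminf (\<lambda>n. ereal (1 / real n) * neg_log (rel_error d M I n (xs n)))
                \<ge> ereal (- ln (rho_max d lam mu) * (1 - g_fun d lam mu x)))"
proof -
  \<comment> \<open>The service rates occupy the indices 1 to d, which leaves index 0 for the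
    arrival rate.\<close>
  define p where "p = mu(0 := lam)"
  have p0: "p 0 = lam" and p: "\<And>i. i \<in> {1..d} \<Longrightarrow> mu i = p i" by (auto simp: p_def)
  interpret prob_space M by fact
  interpret tandem_process d p M I
  proof (unfold_locales)
    show "1 \<le> d" using assms(1) by simp
    show pos: "0 < p v" if "v \<le> d" for v
      using that assms(2,3) by (cases "v = 0") (auto simp: p_def)
    have "{..d} = insert 0 {1..d}" by auto
    then have "(\<Sum>v\<le>d. p v) = p 0 + (\<Sum>i=1..d. p i)" by simp
    also have "(\<Sum>i=1..d. p i) = (\<Sum>i=1..d. mu i)" by (intro sum.cong) (auto simp: p)
    finally show "(\<Sum>v\<le>d. p v) = 1" using assms(4) p0 by simp
    show less: "p 0 < p v" if "v \<in> {1..d}" for v using that assms(5) p0 p[OF that] by force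
    show "indep_vars (\<lambda>_. count_space (vectors d)) I {1..}"
      using assms(7) by (simp add: iid_increments_def)
    interpret tandem d p
      by unfold_locales (use assms(1) pos less \<open>(\<Sum>v\<le>d. p v) = 1\<close> in auto)
    fix k v :: nat assume k: "1 \<le> k" and v: "v \<le> d"
    consider "v = 0" | "v = d" "v \<noteq> 0" | "v \<in> {1..<d}" using v by fastforce
    then show "prob {\<omega> \<in> space M. I k \<omega> = tandem.increment d v} = p v"
      using assms(7) k by cases (auto simp: iid_increments_def increment_def p_def)
  qed
  have load: "rho_max d lam mu = load" using rho_max_eq_load[of mu] p p0 by simp
  have ln_load: "0 < - ln load" using load_pos load_less_1 by simp
  show ?thesis
    unfolding load
  proof (intro conjI allI ballI impI)
    fix \<epsilon> :: real assume "0 < \<epsilon>"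
    then show "\<exists>n0::nat. n0 > 0 \<and> (\<forall>n>n0. \<forall>x\<in>R_bar d lam mu n.
        rel_error d M I n x \<le> load powr (real n * (1 - g_fun d lam mu (scaled n x) - \<epsilon>)))"
      using rel_error_le[of mu \<epsilon>] p unfolding p0 by metis
  next
    fix xs :: "nat \<Rightarrow> nat \<Rightarrow> int" and x
    assume x: "x \<in> A_set d - R_rho d lam mu"
      and xs: "(\<forall>n\<ge>1. xs n \<in> orthant d) \<and> (\<forall>j\<in>{1..d}. (\<lambda>n. scaled n (xs n) j) \<longlonglongrightarrow> x j)"
    have "g_fun d lam mu x < 1" using g_fun_less_1[of mu x] p x unfolding p0 by blast
    then show "0 < - ln load * (1 - g_fun d lam mu x)" using ln_load by (intro mult_pos_pos) auto
    show "ereal (- ln load * (1 - g_fun d lam mu x))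
        \<le> liminf (\<lambda>n. ereal (1 / real n) * neg_log (rel_error d M I n (xs n)))"
      using liminf_rel_error_ge[of mu x xs] p x xs unfolding p0 by blast
  qed
qed

end
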